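(* For every integer $d\geqslant 5$, $QP_5^+((3)|^d)$ is an $\mathbb F_2$-vector space of dimension $90$, and $\dim QP_5((3)|^d) = 155$.
   Context: $P_5=\mathbb F_2[x_1,\dots,x_5]$ with $\deg x_i=1$, a module over the mod-2 Steenrod algebra $\mathcal A$ with augmentation ideal $\mathcal A^+$. For a monomial $x=x_1^{a_1}\cdots x_5^{a_5}$, its weight vector is $\omega(x)=(\omega_1(x),\omega_2(x),\dots)$ with $\omega_i(x)=\sum_j\alpha_{i-1}(a_j)$, $\alpha_r(a)$ the $r$-th binary digit of $a$; weight vectors are ordered left-lexicographically, and $\deg\omega=\sum_i2^{i-1}\omega_i$. For a weight vector $\omega$, $P_5(\omega)$ is spanned by monomials $y$ with $\deg y=\deg\omega$ and $\omega(y)\le\omega$, and $P_5^-(\omega)$ by those with $\omega(y)<\omega$. $QP_5(\omega)$ is the quotient of $P_5(\omega)$ by the relation $f\equiv_\omega g \iff f+g\in\mathcal A^+P_5+P_5^-(\omega)$. $QP_5^+(\omega)$ is the subspace of $QP_5(\omega)$ spanned by the classes of monomials $x_1^{a_1}\cdots x_5^{a_5}\in P_5(\omega)$ with $a_1a_2\cdots a_5>0$. $(3)|^d$ denotes the weight vector $(3,3,\dots,3,0,0,\dots)$ with $d$ entries equal to $3$. *)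

theory Defs
  imports Main HOL.Vector_Spaces "HOL-Library.Z2" "HOL-Library.Function_Algebras"
begin

text \<open>Monomials of P_5 are exponent vectors a :: nat \<Rightarrow> nat supported on {0..<5}
  (a j = exponent of x_(j+1)).  Polynomials over F_2 are functions from exponent
  vectors to bit (coefficient of each monomial); all subspaces considered below
  are spans of genuine (finitely supported) polynomials.\<close>

type_synonym expv = "nat \<Rightarrow> nat"
type_synonym poly = "expv \<Rightarrow> bit"

definition mono5 :: "expv \<Rightarrow> bool" where
  "mono5 a \<longleftrightarrow> (\<forall>j\<ge>5. a j = 0)"

definition mdeg :: "expv \<Rightarrow> nat" where
  "mdeg a = (\<Sum>j<5. a j)"

definition monomial :: "expv \<Rightarrow> poly" where
  "monomial a = (\<lambda>b. if b = a then 1 else 0)"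

definition scl :: "bit \<Rightarrow> poly \<Rightarrow> poly" where
  "scl c f = (\<lambda>b. c * f b)"

abbreviation span2 :: "poly set \<Rightarrow> poly set" where
  "span2 S \<equiv> module.span scl S"

abbreviation dim2 :: "poly set \<Rightarrow> nat" where
  "dim2 S \<equiv> vector_space.dim scl S"

definition P5 :: "poly set" where
  "P5 = span2 {monomial a | a. mono5 a}"

text \<open>Steenrod square Sq^k on a monomial, via Sq(x_j)=x_j+x_j^2 and the Cartan formula:
  Sq^k(x^a) = sum over b \<ge> a with |b - a| = k of prod_j binom(a_j, b_j - a_j) x^b (mod 2).\<close>
definition Sq :: "nat \<Rightarrow> expv \<Rightarrow> poly" where
  "Sq k a = (\<lambda>b. if (\<forall>j. a j \<le> b j) \<and> (\<forall>j\<ge>5. b j = a j) \<and> (\<Sum>j<5. b j - a j) = k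
                 then of_nat (\<Prod>j<5. (a j choose (b j - a j))) else 0)"

text \<open>A^+ P_5: the image of the augmentation ideal, i.e. the span of all Sq^k(P_5), k > 0
  (A^+ is spanned by composites of Sq^k with k > 0, and each Sq^k is linear).\<close>
definition AplusP5 :: "poly set" where
  "AplusP5 = span2 {Sq k a | k a. 0 < k \<and> mono5 a}"

text \<open>Weight vectors: w i is omega_(i+1), i.e. indices are shifted to start at 0.\<close>
definition weight :: "expv \<Rightarrow> nat \<Rightarrow> nat" where
  "weight a i = (\<Sum>j<5. (a j div 2 ^ i) mod 2)"

definition wdeg :: "(nat \<Rightarrow> nat) \<Rightarrow> nat \<Rightarrow> nat" where
  "wdeg w len = (\<Sum>i<len. 2 ^ i * w i)"

definition wless :: "(nat \<Rightarrow> nat) \<Rightarrow> (nat \<Rightarrow> nat) \<Rightarrow> bool" where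
  "wless v w \<longleftrightarrow> (\<exists>i. (\<forall>j<i. v j = w j) \<and> v i < w i)"

definition three_d :: "nat \<Rightarrow> nat \<Rightarrow> nat" where
  "three_d d i = (if i < d then 3 else 0)"

definition deg_three_d :: "nat \<Rightarrow> nat" where
  "deg_three_d d = wdeg (three_d d) d"

definition Pw :: "nat \<Rightarrow> poly set" where
  "Pw d = span2 {monomial a | a. mono5 a \<and> mdeg a = deg_three_d d
                   \<and> (weight a = three_d d \<or> wless (weight a) (three_d d))}"

definition Pw_minus :: "nat \<Rightarrow> poly set" where
  "Pw_minus d = span2 {monomial a | a. mono5 a \<and> mdeg a = deg_three_d d
                   \<and> wless (weight a) (three_d d)}"

text \<open>The subspace K of P_5(omega) by which we quotient:
  f \<equiv>_omega g iff f + g \<in> A^+P_5 + P_5^-(omega).\<close>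
definition Kw :: "nat \<Rightarrow> poly set" where
  "Kw d = Pw d \<inter> span2 (AplusP5 \<union> Pw_minus d)"

text \<open>Dimension of the image of a subspace U \<subseteq> V in the quotient V / K
  (the image is (U + K)/K, of dimension dim(U+K) - dim K).\<close>
definition quot_image_dim :: "poly set \<Rightarrow> poly set \<Rightarrow> nat" where
  "quot_image_dim U K = dim2 (span2 (U \<union> K)) - dim2 K"

definition dim_QP :: "nat \<Rightarrow> nat" where
  "dim_QP d = quot_image_dim (Pw d) (Kw d)"

definition dim_QP_plus :: "nat \<Rightarrow> nat" where
  "dim_QP_plus d = quot_image_dim
     (span2 {monomial a | a. mono5 a \<and> mdeg a = deg_three_d d
              \<and> (weight a = three_d d \<or> wless (weight a) (three_d d))
              \<and> (\<forall>j<5. 0 < a j)}) (Kw d)"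

end

theory Submission
  imports Defs "HOL-Library.Multiset" "HOL-Library.FuncSet" "HOL-Computational_Algebra.Polynomial"
begin

text \<open>
  Each binary digit position of a monomial of weight \<open>(3)|\<^sup>d\<close> selects three of the five variables;
  recording the two remaining ones turns the monomial into a word of length \<open>d\<close> in the edges of \<open>K\<^sub>5\<close>.

  Upper bound. Applying \<open>Sq\<close> of a power of two to a single monomial gives, modulo lower weight, the relations
  \<open>vx\<cdot>vy = vy\<cdot>vx\<close> and \<open>vx\<cdot>yz + vy\<cdot>xz + vz\<cdot>xy = 0\<close> for adjacent letters, and the same relations with
  the first letter doubled. For \<open>d \<ge> 5\<close> they force the class of a word to depend only on its set of
  letters, a graph on five vertices, and for every graph \<open>H\<close> with at most \<open>d - 2\<close> edges the three graphs
  \<open>H + {vx, yz}\<close>, \<open>H + {vy, xz}\<close>, \<open>H + {vz, xy}\<close> sum to zero. A finite elimination reduces all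
  nonempty graphs to 155 of them. The exponent of \<open>x\<^sub>v\<close> vanishes exactly if all edges contain \<open>v\<close>; the
  65 stars are among the 155 normal graphs, and the other 90 normal graphs span the positive part.

  Lower bound. Substituting linear forms in three variables \<open>y\<^sub>1, y\<^sub>2, y\<^sub>3\<close> for the \<open>x\<^sub>j\<close> and taking the
  coefficient of \<open>(y\<^sub>1y\<^sub>2y\<^sub>3)\<close> to the power \<open>2\<^sup>d - 1\<close> is a functional that kills hit polynomials and
  lower weights, since this monomial does not occur in \<open>Sq\<^sup>k\<close> for \<open>k > 0\<close>; on a word it is the
  product of the \<open>3\<times>3\<close> minors complementary to its letters. Sums of such functionals are
  triangular on the normal graphs.
\<close>

section \<open>Words in the edges of the complete graph on five vertices\<close>

definition edges :: "nat set set" where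
  "edges = {{i, j} | i j. i < 5 \<and> j < 5 \<and> i \<noteq> j}"

lemma edgesI: "i < 5 \<Longrightarrow> j < 5 \<Longrightarrow> i \<noteq> j \<Longrightarrow> {i,j} \<in> edges"
  by (auto simp: edges_def)

definition quad :: "nat \<Rightarrow> nat \<Rightarrow> nat \<Rightarrow> nat \<Rightarrow> bool" where
  "quad v x y z \<longleftrightarrow> distinct [v, x, y, z] \<and> v < 5 \<and> x < 5 \<and> y < 5 \<and> z < 5"

lemma quad_perm:
  assumes "quad v x y z"
  shows "quad x v y z" "quad v y x z" "quad v x z y"
  using assms by (auto simp: quad_def)

lemma quad_symmetric:
  fixes D :: "nat \<Rightarrow> nat \<Rightarrow> nat \<Rightarrow> nat \<Rightarrow> bool"
  assumes swap: "\<And>p q r s. D p q r s = D q p r s" "\<And>p q r s. D p q r s = D p q s r"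
    and matching: "\<And>p q r s. quad p q r s \<Longrightarrow> D p q r s = D p r q s"
    and "quad v x y z" "quad v' x' y' z'" "{v',x',y',z'} = {v,x,y,z}"
  shows "D v' x' y' z' = D v x y z"
proof -
  define R where "R = (\<lambda>p q r s. quad p q r s \<and> {p,q,r,s} = {v,x,y,z} \<and> D v' x' y' z' = D p q r s)"
  have R0: "R v' x' y' z'" using assms by (simp add: R_def)
  have s: "R q p r s" "R p r q s" "R p q s r" if "R p q r s" for p q r s
  proof -
    have h: "quad p q r s" "{p,q,r,s} = {v,x,y,z}" "D v' x' y' z' = D p q r s"
      using that by (auto simp: R_def)
    have e: "{q,p,r,s} = {p,q,r,s}" "{p,r,q,s} = {p,q,r,s}" "{p,q,s,r} = {p,q,r,s}" by auto
    show "R q p r s" "R p r q s" "R p q s r" unfolding R_def e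
      using h quad_perm[OF h(1)] matching[OF h(1)] swap[of p q r s] by simp_all
  qed
  have mem: "t = v' \<or> t = x' \<or> t = y' \<or> t = z'" if "t \<in> {v,x,y,z}" for t
    using that unfolding assms(6)[symmetric] by simp
  have "v = v' \<or> v = x' \<or> v = y' \<or> v = z'" by (rule mem) simp
  then obtain a b c where 1: "R v a b c" using R0 s by metis
  then have "{v,a,b,c} = {v,x,y,z}" by (simp add: R_def)
  then have "x \<in> {v,a,b,c}" by simp
  moreover have "x \<noteq> v" using assms(4) by (simp add: quad_def)
  ultimately have "x = a \<or> x = b \<or> x = c" by simp
  then obtain b' c' where 2: "R v x b' c'" using 1 s by metis
  then have 3: "{v,x,b',c'} = {v,x,y,z}" "quad v x b' c'" by (simp_all add: R_def)
  have "y \<in> {v,x,b',c'}" "z \<in> {v,x,b',c'}" unfolding 3(1) by simp_all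
  then have "b' = y \<and> c' = z \<or> b' = z \<and> c' = y" using assms(4) 3(2) by (auto simp: quad_def)
  then have "R v x y z" using 2 s(3) by metis
  then show ?thesis by (simp add: R_def)
qed

lemma vertices_eq:
  assumes "distinct [a, v, x, y, z]" "a < 5" "v < 5" "x < 5" "y < 5" "z < (5::nat)"
  shows "{v,x,y,z} = {..<5} - {a}"
proof (rule card_seteq)
  show "card ({..<5} - {a}) \<le> card {v,x,y,z}" using assms by simp
qed (use assms in auto)

lemma others:
  assumes "distinct bs" "set bs \<subseteq> {..<5::nat}"
  obtains cs where "distinct (bs @ cs)" "set cs \<subseteq> {..<5}" "length cs = 5 - length bs"
proof
  let ?cs = "sorted_list_of_set ({..<5} - set bs)"
  show "distinct (bs @ ?cs)" "set ?cs \<subseteq> {..<5}" using assms by auto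
  show "length ?cs = 5 - length bs"
    using assms by (simp add: card_Diff_subset distinct_card)
qed

lemma edges_cases:
  assumes "e \<in> edges" "f \<in> edges" "e \<noteq> f"
  obtains v x y where "e = {v,x}" "f = {v,y}" "distinct [v,x,y]" "v < 5" "x < 5" "y < 5"
  | v x y z where "e = {v,x}" "f = {y,z}" "quad v x y z"
proof -
  obtain i j k l where *: "e = {i,j}" "i < 5" "j < 5" "i \<noteq> j" "f = {k,l}" "k < 5" "l < 5" "k \<noteq> l"
    using assms unfolding edges_def by auto
  have c: "{j,i} = {i,j}" "{l,k} = {k,l}" by auto
  consider "i = k" | "i = l" | "j = k" | "j = l" | "i \<noteq> k" "i \<noteq> l" "j \<noteq> k" "j \<noteq> l" by auto
  then show thesis
  proof cases
    case 1 then show thesis using that(1)[of i j l] * assms(3) c by auto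
  next
    case 2 then show thesis using that(1)[of i j k] * assms(3) c by auto
  next
    case 3 then show thesis using that(1)[of j i l] * assms(3) c by auto
  next
    case 4 then show thesis using that(1)[of j i k] * assms(3) c by auto
  next
    case 5 then show thesis using that(2)[of i j k l] * by (auto simp: quad_def)
  qed
qed

lemma swap_invariant_mset:
  assumes swap: "\<And>u e f w. Q (u @ e # f # w) = Q (u @ f # e # w)" and "mset xs = mset ys"
  shows "Q xs = Q ys"
proof -
  have move: "Q (u @ p @ x # s) = Q (u @ x # p @ s)" for u p x s
  proof (induction p arbitrary: u)
    case (Cons a p)
    have "Q (u @ (a # p) @ x # s) = Q (u @ a # x # p @ s)" using Cons[of "u @ [a]"] by simp
    then show ?case using swap by simp
  qed simp
  have "Q (u @ xs) = Q (u @ ys)" for u using assms(2)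
  proof (induction xs arbitrary: u ys)
    case (Cons x xs)
    then have "x \<in> set ys" by (metis list.set_intros(1) mset_eq_setD)
    then obtain p s where ys: "ys = p @ x # s" by (meson split_list)
    have "Q (u @ x # xs) = Q (u @ x # p @ s)"
      using Cons.IH[of "p @ s" "u @ [x]"] Cons.prems ys by simp
    then show ?case using move ys by simp
  qed simp
  from this[of "[]"] show ?thesis by simp
qed

text \<open>A linear functional vanishing on the hit polynomials is viewed as a Boolean function of words that is
  false on all words that do not have length \<open>d\<close> or use letters that are not edges. The relations
  then hold for arbitrary contexts \<open>u\<close> and \<open>w\<close>.\<close>
locale plucker_words =
  fixes d :: nat and Q :: "nat set list \<Rightarrow> bool"
  assumes length_Q: "Q w \<Longrightarrow> length w = d"
    and edges_Q: "Q w \<Longrightarrow> set w \<subseteq> edges"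
    and adj: "distinct [v, x, y] \<Longrightarrow> v < 5 \<Longrightarrow> x < 5 \<Longrightarrow> y < 5 \<Longrightarrow>
      Q (u @ {v,x} # {v,y} # w) = Q (u @ {v,y} # {v,x} # w)"
    and plu: "quad v x y z \<Longrightarrow>
      Q (u @ {v,x} # {y,z} # w) = (Q (u @ {v,y} # {x,z} # w) \<noteq> Q (u @ {v,z} # {x,y} # w))"
    and adj_sq: "distinct [v, x, y] \<Longrightarrow> v < 5 \<Longrightarrow> x < 5 \<Longrightarrow> y < 5 \<Longrightarrow>
      Q (u @ {v,x} # {v,x} # {v,y} # w) = Q (u @ {v,y} # {v,y} # {v,x} # w)"
    and plu_sq: "quad v x y z \<Longrightarrow>
      Q (u @ {v,x} # {v,x} # {y,z} # w) =
        (Q (u @ {v,y} # {v,y} # {x,z} # w) \<noteq> Q (u @ {v,z} # {v,z} # {x,y} # w))"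
begin

text \<open>The defect of commutativity of two disjoint edges. It is the same for the three perfect matchings of a
  \<open>K\<^sub>4\<close>, hence depends only on the vertex \<open>a\<close> left out (\<open>Del\<close>), and every further letter on the left
  or any two on the right annihilate it.\<close>
definition del :: "nat set list \<Rightarrow> nat set list \<Rightarrow> nat \<Rightarrow> nat \<Rightarrow> nat \<Rightarrow> nat \<Rightarrow> bool" where
  "del u w v x y z \<longleftrightarrow> Q (u @ {v,x} # {y,z} # w) \<noteq> Q (u @ {y,z} # {v,x} # w)"

lemma del_swap:
  shows "del u w v x y z = del u w y z v x" "del u w v x y z = del u w x v y z"
    "del u w v x y z = del u w v x z y"
  unfolding del_def by (auto simp: insert_commute)

lemma del_matching:
  assumes "quad v x y z"
  shows "del u w v x y z = del u w v y x z"
proof -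
  have "quad z v x y" using assms by (auto simp: quad_def)
  from plu[OF this, of u w] plu[OF assms, of u w] show ?thesis
    unfolding del_def by (simp add: insert_commute) argo
qed

lemma del_inside_left:
  assumes "quad v x y z"
  shows "\<not> del (u @ [{y,z}]) w v y x z"
proof -
  have q: "quad z v x y" using assms by (auto simp: quad_def)
  have 1: "Q (u @ {y,z} # {v,x} # {y,z} # w) =
      (Q (u @ {y,z} # {v,y} # {x,z} # w) \<noteq> Q (u @ {y,z} # {v,z} # {x,y} # w))"
    using plu[OF assms, of "u @ [{y,z}]" w] by simp
  have 2: "Q (u @ {v,z} # {x,y} # {y,z} # w) =
      (Q (u @ {x,z} # {v,y} # {y,z} # w) \<noteq> Q (u @ {y,z} # {v,x} # {y,z} # w))"
    using plu[OF q, of u "{y,z} # w"] by (simp add: insert_commute)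
  have 3: "Q (u @ {v,z} # {x,y} # {y,z} # w) = Q (u @ {y,z} # {v,z} # {x,y} # w)"
    using adj[of y x z "u @ [{v,z}]" w] adj[of z v y u "{x,y} # w"] assms
    by (simp add: insert_commute quad_def)
  have 4: "Q (u @ {x,z} # {v,y} # {y,z} # w) = Q (u @ {y,z} # {x,z} # {v,y} # w)"
    using adj[of y v z "u @ [{x,z}]" w] adj[of z x y u "{v,y} # w"] assms
    by (simp add: insert_commute quad_def)
  show ?thesis using 1 2 3 4 unfolding del_def append_assoc append.simps by argo
qed

lemma del_inside_right:
  assumes "quad v x y z"
  shows "\<not> del u ({y,z} # w) v y x z"
proof -
  have 3: "Q (u @ {v,y} # {x,z} # {y,z} # w) = Q (u @ {y,z} # {v,y} # {x,z} # w)"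
    using adj[of z x y "u @ [{v,y}]" w] adj[of y v z u "{x,z} # w"] assms
    by (simp add: insert_commute quad_def)
  have 4: "Q (u @ {x,z} # {v,y} # {y,z} # w) = Q (u @ {y,z} # {x,z} # {v,y} # w)"
    using adj[of y v z "u @ [{x,z}]" w] adj[of z x y u "{v,y} # w"] assms
    by (simp add: insert_commute quad_def)
  show ?thesis using del_inside_left[OF assms, of u w] 3 4 unfolding del_def
    by (simp add: insert_commute)
qed

lemma del_outside_right_sum:
  assumes "distinct [a, v, x, y, z]" "a < 5" "v < 5" "x < 5" "y < 5" "z < 5"
  shows "del (u @ [{a,v}]) w v x y z = (del u ({v,z} # w) v x a y \<noteq> del u ({v,y} # w) v x a z)"
proof -
  have q: "quad a v y z" using assms by (auto simp: quad_def)
  note 1 = plu[OF q, of "u @ [{v,x}]" w] plu[OF q, of u "{v,x} # w"]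
  have 2: "Q (u @ {a,v} # {v,x} # {y,z} # w) = Q (u @ {v,x} # {a,v} # {y,z} # w)"
    using adj[of v a x u "{y,z} # w"] assms by (auto simp: insert_commute)
  have 3: "Q (u @ {a,y} # {v,z} # {v,x} # w) = Q (u @ {a,y} # {v,x} # {v,z} # w)"
    using adj[of v z x "u @ [{a,y}]" w] assms by auto
  have 4: "Q (u @ {a,z} # {v,y} # {v,x} # w) = Q (u @ {a,z} # {v,x} # {v,y} # w)"
    using adj[of v y x "u @ [{a,z}]" w] assms by auto
  show ?thesis using 1 2 3 4 unfolding del_def by simp argo
qed

lemma del_outside_left_sum:
  assumes "distinct [a, v, x, y, z]" "a < 5" "v < 5" "x < 5" "y < 5" "z < 5"
  shows "del (u @ [{a,v}]) w v x y z = (del (u @ [{v,z}]) w v x a y \<noteq> del (u @ [{v,y}]) w v x a z)"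
proof -
  have q: "quad v a z y" using assms by (auto simp: quad_def)
  note 1 = plu[OF q, of "u @ [{v,x}]" w] plu[OF q, of u "{v,x} # w"]
  have 2: "Q (u @ {a,v} # {v,x} # {y,z} # w) = Q (u @ {v,x} # {a,v} # {y,z} # w)"
    using adj[of v a x u "{y,z} # w"] assms by (auto simp: insert_commute)
  have 3: "Q (u @ {v,x} # {v,z} # {a,y} # w) = Q (u @ {v,z} # {v,x} # {a,y} # w)"
    using adj[of v z x u "{a,y} # w"] assms by auto
  have 4: "Q (u @ {v,x} # {v,y} # {a,z} # w) = Q (u @ {v,y} # {v,x} # {a,z} # w)"
    using adj[of v y x u "{a,z} # w"] assms by auto
  show ?thesis using 1 2 3 4 unfolding del_def by (simp add: insert_commute) argo
qed

lemma del_outside_left: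
  assumes "distinct [a, v, x, y, z]" "a < 5" "v < 5" "x < 5" "y < 5" "z < 5"
  shows "\<not> del (u @ [{a,v}]) w v x y z"
proof -
  let ?L = "\<lambda>b x y z. del (u @ [{v,b}]) w v x y z"
  have m: "?L b p r s = ?L b r p s" if "quad v p r s" for b p r s by (rule del_matching[OF that])
  have s: "?L b p r s = ?L b p s r" for b p r s by (rule del_swap(3))
  have 1: "?L a x y z = (?L z x a y \<noteq> ?L y x a z)"
    using del_outside_left_sum[of a v x y z u w] assms by (auto simp: insert_commute)
  have 2: "?L a y x z = (?L z y a x \<noteq> ?L x y a z)"
    using del_outside_left_sum[of a v y x z u w] assms by (auto simp: insert_commute)
  have 3: "?L a z x y = (?L y z a x \<noteq> ?L x z a y)"
    using del_outside_left_sum[of a v z x y u w] assms by (auto simp: insert_commute)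
  have q: "quad v x y z" "quad v y z x" "quad v x y a" "quad v x z a" "quad v y z a"
    using assms by (auto simp: quad_def)
  have e: "?L a x y z = ?L a y x z" "?L a y x z = ?L a z x y" "?L z x a y = ?L z y a x"
     "?L y x a z = ?L y z a x" "?L x y a z = ?L x z a y"
    using m[OF q(1), of a] m[OF q(2), of a] s[of a y x z] s[of a z x y]
      m[OF q(3), of z] s[of z x a y] s[of z y a x] m[OF q(4), of y] s[of y x a z] s[of y z a x]
      m[OF q(5), of x] s[of x y a z] s[of x z a y] by argo+
  have "\<not> ?L a x y z" using 1 2 3 e by argo
  then show ?thesis by (simp add: insert_commute)
qed

lemma del_sym:
  assumes "quad v x y z" "quad v' x' y' z'" "{v',x',y',z'} = {v,x,y,z}"
  shows "del u w v' x' y' z' = del u w v x y z"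
  by (rule quad_symmetric[OF del_swap(2,3) del_matching assms])

definition Del :: "nat set list \<Rightarrow> nat set list \<Rightarrow> nat \<Rightarrow> bool" where
  "Del u w a \<longleftrightarrow> (\<exists>v x y z. quad v x y z \<and> a \<notin> {v,x,y,z} \<and> del u w v x y z)"

lemma Del_eq:
  assumes "distinct [a, v, x, y, z]" "a < 5" "v < 5" "x < 5" "y < 5" "z < 5"
  shows "Del u w a = del u w v x y z"
proof
  have q: "quad v x y z" using assms by (simp add: quad_def)
  show "del u w v x y z" if D: "Del u w a"
  proof -
    obtain v' x' y' z' where *: "quad v' x' y' z'" "a \<notin> {v',x',y',z'}" "del u w v' x' y' z'"
      using D by (auto simp: Del_def)
    have "{v',x',y',z'} = {v,x,y,z}"
      using vertices_eq[OF assms] vertices_eq[of a v' x' y' z'] * assms by (simp add: quad_def)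
    with del_sym[OF q *(1)] *(3) show ?thesis by simp
  qed
  show "Del u w a" if "del u w v x y z" using that q assms by (auto simp: Del_def)
qed

lemma Del_inside:
  assumes "f \<in> edges" "a \<notin> f" "a < 5"
  shows "\<not> Del (u @ [f]) w a" "\<not> Del u (f # w) a"
proof -
  obtain i j where f: "f = {i,j}" "i < 5" "j < 5" "i \<noteq> j" using assms(1) by (auto simp: edges_def)
  obtain cs where cs: "distinct ([a,i,j] @ cs)" "set cs \<subseteq> {..<5}" "length cs = 5 - length [a,i,j]"
    by (rule others[of "[a,i,j]"]) (use f assms in auto)
  then obtain s q where "cs = [s,q]" by (auto simp: numeral_eq_Suc length_Suc_conv)
  then have *: "distinct [a,s,i,q,j]" "s < 5" "q < 5" using cs by auto
  have "quad s q i j" using * f by (auto simp: quad_def)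
  from del_inside_left[OF this] del_inside_right[OF this] show "\<not> Del (u @ [f]) w a" "\<not> Del u (f # w) a"
    using Del_eq[OF *(1)] * f assms by auto
qed

lemma Del_outside_left:
  assumes "a \<noteq> v" "a < 5" "v < 5"
  shows "\<not> Del (u @ [{a,v}]) w a"
proof -
  obtain cs where cs: "distinct ([a,v] @ cs)" "set cs \<subseteq> {..<5}" "length cs = 5 - length [a,v]"
    by (rule others[of "[a,v]"]) (use assms in auto)
  then obtain x y z where "cs = [x,y,z]" by (auto simp: numeral_eq_Suc length_Suc_conv)
  then have *: "distinct [a,v,x,y,z]" "x < 5" "y < 5" "z < 5" using cs by auto
  show ?thesis using del_outside_left[OF *(1)] Del_eq[OF *(1)] * assms by auto
qed

lemma Del_after:
  assumes "f \<in> edges" "a < 5"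
  shows "\<not> Del (u @ [f]) w a"
proof (cases "a \<in> f")
  case True
  then obtain v where "f = {a,v}" "v \<noteq> a" "v < 5" using assms(1) unfolding edges_def by auto
  then show ?thesis using Del_outside_left assms by auto
next
  case False
  then show ?thesis using Del_inside assms by auto
qed

lemma Del_outside_right:
  assumes "distinct [v, z, y]" "v < 5" "z < 5" "y < 5"
  shows "Del u ({v,z} # w) z = Del u ({v,y} # w) y"
proof -
  obtain cs where cs: "distinct ([v,z,y] @ cs)" "set cs \<subseteq> {..<5}" "length cs = 5 - length [v,z,y]"
    by (rule others[of "[v,z,y]"]) (use assms in auto)
  then obtain a x where "cs = [a,x]" by (auto simp: numeral_eq_Suc length_Suc_conv)
  then have *: "distinct [a,v,x,y,z]" "a < 5" "x < 5" using cs by auto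
  have z: "distinct [z,v,x,a,y]" and y: "distinct [y,v,x,a,z]" using * by auto
  show ?thesis
    using del_outside_right_sum[OF *(1)] del_outside_left[OF *(1)] Del_eq[OF z] Del_eq[OF y] * assms
    by auto
qed

lemma Del_adj:
  assumes "distinct [v, x, y]" "v < 5" "x < 5" "y < 5"
  shows "Del u ({v,x} # {v,y} # w) a = Del u ({v,y} # {v,x} # w) a"
  using adj[OF assms, of "u @ [_, _]" w] unfolding Del_def del_def by simp

lemma Del_plu:
  assumes "quad v x y z" "a < 5"
  shows "Del u ({v,x} # {y,z} # w) a = (Del u ({v,y} # {x,z} # w) a \<noteq> Del u ({v,z} # {x,y} # w) a)"
proof -
  obtain cs where cs: "distinct ([a] @ cs)" "set cs \<subseteq> {..<5}" "length cs = 5 - length [a]"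
    by (rule others[of "[a]"]) (use assms in auto)
  then obtain p q r s where "cs = [p,q,r,s]" by (auto simp: numeral_eq_Suc length_Suc_conv)
  then have *: "distinct [a,p,q,r,s]" "p < 5" "q < 5" "r < 5" "s < 5" using cs by auto
  show ?thesis
    using plu[OF assms(1), of "u @ [_, _]" w] 
    unfolding Del_eq[OF *(1) assms(2) *(2-5)] del_def by simp argo
qed

lemma Del_two_after_vertex:
  assumes "b \<noteq> c" "b < 5" "c < 5" "a \<noteq> b" "a < 5"
  shows "\<not> Del u ({a,b} # {b,c} # w) a"
proof -
  have *: "\<not> Del u ({p,b} # {b,c} # w) p" if "p \<noteq> b" "p \<noteq> c" "p < 5" for p
    using Del_adj[of b p c u w p] Del_inside(2)[OF edgesI[of b c], of p u "{p,b} # w"] that assms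
    by (auto simp: insert_commute)
  show ?thesis
  proof (cases "a = c")
    case False then show ?thesis using * assms by auto
  next
    case True
    obtain cs where cs: "distinct ([b,c] @ cs)" "set cs \<subseteq> {..<5}" "length cs = 5 - length [b,c]"
      by (rule others[of "[b,c]"]) (use assms in auto)
    then obtain p q r where "cs = [p,q,r]" by (auto simp: numeral_eq_Suc length_Suc_conv)
    then have p: "p \<noteq> b" "p \<noteq> c" "p < 5" using cs by auto
    show ?thesis using *[OF p] Del_outside_right[of b p a u "{b,c} # w"] p assms True
      by (simp add: insert_commute)
  qed
qed

lemma Del_two_after_opposite:
  assumes "distinct [b, c, e]" "b < 5" "c < 5" "e < 5" "a \<noteq> b" "a < 5"
  shows "\<not> Del u ({a,b} # {c,e} # w) a"
proof -
  obtain cs where cs: "distinct ([b,c,e] @ cs)" "set cs \<subseteq> {..<5}" "length cs = 5 - length [b,c,e]"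
    by (rule others[of "[b,c,e]"]) (use assms in auto)
  then obtain p q where "cs = [p,q]" by (auto simp: numeral_eq_Suc length_Suc_conv)
  then have p: "distinct [b,c,e,p]" "p < 5" using cs by auto
  let ?T = "\<lambda>b c e. Del u ({p,b} # {c,e} # w) p"
  have tr: "Del u ({r,s} # w) r = Del u ({p,s} # w) p" if "r \<noteq> s" "s \<noteq> p" "r < 5" "s < 5" for r s w
    using Del_outside_right[of s r p u w] that p by (cases "r = p") (auto simp: insert_commute)
  have 1: "?T b c e = ?T e c b"
    using tr[of c b "{c,e} # w"] tr[of c e "{c,b} # w"] Del_adj[of c b e u w c] assms p
    by (auto simp: insert_commute)
  have 2: "?T b c e = ?T c b e"
    using tr[of e b "{c,e} # w"] tr[of e c "{b,e} # w"] Del_adj[of e b c u w e] assms p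
    by (auto simp: insert_commute)
  have "quad p b c e" using assms p by (auto simp: quad_def)
  from Del_plu[OF this p(2), of u w] 1 2 have "\<not> ?T b c e"
    by (simp add: insert_commute)
  then show ?thesis using tr[of a b "{c,e} # w"] assms p by auto
qed

lemma Del_two_after:
  assumes "f \<in> edges" "g \<in> edges" "a < 5"
  shows "\<not> Del u (f # g # w) a"
proof (cases "a \<in> f")
  case False then show ?thesis using Del_inside(2) assms by auto
next
  case True
  then obtain b where b: "f = {a,b}" "b \<noteq> a" "b < 5" using assms(1) unfolding edges_def by auto
  show ?thesis
  proof (cases "b \<in> g")
    case True
    then obtain c where "g = {b,c}" "c \<noteq> b" "c < 5" using assms(2) unfolding edges_def by auto
    then show ?thesis using Del_two_after_vertex b assms by auto
  next
    case False
    then obtain c e where "g = {c,e}" "distinct [b,c,e]" "c < 5" "e < 5"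
      using assms(2) unfolding edges_def by auto
    then show ?thesis using Del_two_after_opposite b assms by auto
  qed
qed

lemma comm:
  assumes "4 \<le> d"
  shows "Q (u @ e # f # w) = Q (u @ f # e # w)"
proof (cases "set (u @ e # f # w) \<subseteq> edges \<and> length (u @ e # f # w) = d \<and> e \<noteq> f")
  case False
  then show ?thesis using edges_Q[of "u @ e # f # w"] edges_Q[of "u @ f # e # w"]
     length_Q[of "u @ e # f # w"] length_Q[of "u @ f # e # w"] by (cases "e = f") auto
next
  case True
  then have ef: "e \<in> edges" "f \<in> edges" "e \<noteq> f" by auto
  from ef show ?thesis
  proof (cases rule: edges_cases)
    case (1 v x y)
    then show ?thesis using adj by auto
  next
    case (2 v x y z)
    obtain cs where cs: "distinct ([v,x,y,z] @ cs)" "set cs \<subseteq> {..<5}" "length cs = 5 - length [v,x,y,z]"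
      by (rule others[of "[v,x,y,z]"]) (use 2 in \<open>auto simp: quad_def\<close>)
    then obtain a where "cs = [a]" by (auto simp: numeral_eq_Suc length_Suc_conv)
    then have a: "distinct [a,v,x,y,z]" "a < 5" using cs by auto
    have "\<not> Del u w a"
    proof (cases u rule: rev_cases)
      case (snoc u' g)
      then show ?thesis using Del_after[of g a u' w] True a by auto
    next
      case Nil
      then obtain g h w' where "w = g # h # w'"
        using True assms by (cases w; cases "tl w") auto
      then show ?thesis using Del_two_after[of g h a u w'] True a Nil by auto
    qed
    then show ?thesis using Del_eq[OF a(1), of u w] 2 a by (auto simp: quad_def del_def)
  qed
qed

lemma Q_mset: "4 \<le> d \<Longrightarrow> mset xs = mset ys \<Longrightarrow> Q xs = Q ys"
  using swap_invariant_mset[of Q] comm by blast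

lemma Q_adj_sq:
  assumes "4 \<le> d" "e = {v,x}" "f = {v,y}" "distinct [v,x,y]" "v < 5" "x < 5" "y < 5"
    and "mset xs = {#e,e,f#} + M" "mset ys = {#e,f,f#} + M"
  shows "Q xs = Q ys"
proof -
  obtain w where w: "mset w = M" using ex_mset by blast
  have "Q xs = Q (e # e # f # w)" "Q ys = Q (f # f # e # w)"
    by (rule Q_mset, use assms w in simp_all)+
  then show ?thesis using adj_sq[of v x y "[]" w] assms by simp
qed

text \<open>The defect of \<open>eef = eff\<close> for disjoint edges, treated in the same way as \<open>del\<close>.\<close>
definition eps :: "nat set list \<Rightarrow> nat \<Rightarrow> nat \<Rightarrow> nat \<Rightarrow> nat \<Rightarrow> bool" where
  "eps w v x y z \<longleftrightarrow> Q ({v,x} # {v,x} # {y,z} # w) \<noteq> Q ({v,x} # {y,z} # {y,z} # w)"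

lemma eps_matching:
  assumes "4 \<le> d" "quad v x y z"
  shows "eps w v x y z = eps w v y x z"
proof -
  have "quad z v x y" using assms by (auto simp: quad_def)
  note 1 = plu_sq[OF this, of "[]" w] plu_sq[OF assms(2), of "[]" w]
  have c: "Q (A # B # B # w) = Q (B # B # A # w)" for A B by (rule Q_mset[OF assms(1)]) simp
  show ?thesis using 1 unfolding eps_def c[of "{v,x}"] c[of "{v,y}"]
    by (simp add: insert_commute) argo
qed

lemma eps_sym:
  assumes "4 \<le> d" "quad v x y z" "quad v' x' y' z'" "{v',x',y',z'} = {v,x,y,z}"
  shows "eps w v' x' y' z' = eps w v x y z"
  by (rule quad_symmetric[OF _ _ eps_matching assms(2-)])
    (use assms(1) in \<open>auto simp: eps_def insert_commute\<close>)

lemma eps_inside: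
  assumes "4 \<le> d" "f \<in> edges" "a \<notin> f" "distinct [a,v,x,y,z]" "a < 5" "v < 5" "x < 5" "y < 5" "z < 5"
  shows "\<not> eps (f # w) v x y z"
proof -
  obtain i j where f: "f = {i,j}" "i < 5" "j < 5" "i \<noteq> j" using assms(2) by (auto simp: edges_def)
  obtain cs where cs: "distinct ([a,i,j] @ cs)" "set cs \<subseteq> {..<5}" "length cs = 5 - length [a,i,j]"
    by (rule others[of "[a,i,j]"]) (use f assms in auto)
  then obtain s q where "cs = [s,q]" by (auto simp: numeral_eq_Suc length_Suc_conv)
  then have *: "distinct [a,s,i,q,j]" "s < 5" "q < 5" using cs by auto
  have set: "{s,i,q,j} = {v,x,y,z}"
    using vertices_eq[OF *(1)] vertices_eq[OF assms(4)] * f assms by auto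
  have q: "quad v x y z" "quad s i q j" using * f assms by (auto simp: quad_def)
  have "Q ({s,i} # {s,i} # {q,j} # f # w) = Q ({s,i} # {q,j} # f # f # w)"
    by (rule Q_adj_sq[OF assms(1) insert_commute f(1), where M = "{#{q,j}#} + mset w"])
      (use * f in auto)
  moreover have "Q ({s,i} # {q,j} # {q,j} # f # w) = Q ({s,i} # {q,j} # f # f # w)"
    by (rule Q_adj_sq[OF assms(1) insert_commute f(1)[unfolded insert_commute[of i]], where M = "{#{s,i}#} + mset w"])
      (use * f in auto)
  ultimately have "\<not> eps (f # w) s i q j" by (simp add: eps_def)
  then show ?thesis using eps_sym[OF assms(1) q set] by simp
qed

lemma eps_mset: "4 \<le> d \<Longrightarrow> mset w = mset w' \<Longrightarrow> eps w v x y z = eps w' v x y z"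
  unfolding eps_def using Q_mset by (metis mset.simps(2))

lemma eps_two:
  assumes "4 \<le> d" "f \<in> edges" "g \<in> edges"
    and "distinct [a,v,x,y,z]" "a < 5" "v < 5" "x < 5" "y < 5" "z < 5"
  shows "\<not> eps (f # g # w) v x y z"
proof (cases "a \<in> f \<and> a \<in> g")
  case False
  moreover have "eps (f # g # w) v x y z = eps (g # f # w) v x y z"
    by (rule eps_mset[OF assms(1)]) simp
  ultimately show ?thesis
    using eps_inside[OF assms(1,2) _ assms(4-), of "g # w"] eps_inside[OF assms(1,3) _ assms(4-), of "f # w"]
    by blast
next
  case True
  then obtain p where p: "f = {a,p}" "p \<noteq> a" "p < 5" using assms(2) unfolding edges_def by auto
  from True obtain q where q: "g = {a,q}" "q \<noteq> a" "q < 5" using assms(3) unfolding edges_def by auto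
  have p': "f = {p,a}" and q': "g = {q,a}" using p q by auto
  have quad: "quad v x y z" using assms by (auto simp: quad_def)
  show ?thesis
  proof (cases "p = q")
    case True
    then have gf: "g = f" using p q by simp
    obtain cs where cs: "distinct ([a,p] @ cs)" "set cs \<subseteq> {..<5}" "length cs = 5 - length [a,p]"
      by (rule others[of "[a,p]"]) (use p assms in auto)
    then obtain r s t where "cs = [r,s,t]" by (auto simp: numeral_eq_Suc length_Suc_conv)
    then have *: "distinct [a,p,r,s,t]" "r < 5" "s < 5" "t < 5" using cs by auto
    have set: "{p,r,s,t} = {v,x,y,z}"
      using vertices_eq[OF *(1)] vertices_eq[OF assms(4)] * p assms by auto
    have qd: "quad p r s t" using * p by (auto simp: quad_def)
    have "\<not> eps ({p,r} # f # w) p r s t"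
      by (rule eps_inside[OF assms(1) edgesI _ *(1)]) (use * p assms in auto)
    moreover have "Q ({p,r} # {p,r} # {s,t} # f # g # w) = Q ({p,r} # {p,r} # {s,t} # {p,r} # f # w)"
      by (rule sym, rule Q_adj_sq[OF assms(1) refl p', where M = "{#{p,r}, {s,t}#} + mset w"])
        (use * p(2,3) assms(5) gf in auto)
    moreover have "Q ({p,r} # {s,t} # {s,t} # f # g # w) = Q ({p,r} # {s,t} # {s,t} # {p,r} # f # w)"
      by (rule sym, rule Q_adj_sq[OF assms(1) refl p', where M = "{#{s,t}, {s,t}#} + mset w"])
        (use * p(2,3) assms(5) gf in auto)
    ultimately have "\<not> eps (f # g # w) p r s t" by (simp add: eps_def)
    then show ?thesis using eps_sym[OF assms(1) quad qd set] by simp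
  next
    case False
    obtain cs where cs: "distinct ([a,p,q] @ cs)" "set cs \<subseteq> {..<5}" "length cs = 5 - length [a,p,q]"
      by (rule others[of "[a,p,q]"]) (use p q False assms in auto)
    then obtain r s where "cs = [r,s]" by (auto simp: numeral_eq_Suc length_Suc_conv)
    then have *: "distinct [a,p,r,q,s]" "r < 5" "s < 5" using cs by auto
    have set: "{p,r,q,s} = {v,x,y,z}"
      using vertices_eq[OF *(1)] vertices_eq[OF assms(4)] * p q assms by auto
    have qd: "quad p r q s" using * p q by (auto simp: quad_def)
    have "Q ({p,r} # {p,r} # {q,s} # f # g # w) = Q ({p,r} # f # {q,s} # f # g # w)"
      by (rule Q_adj_sq[OF assms(1) refl p', where M = "{#{q,s}, g#} + mset w"])
        (use * p(2,3) assms(5) in auto)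
    also have "\<dots> = Q ({p,r} # g # {q,s} # f # g # w)"
      by (rule Q_adj_sq[OF assms(1) p(1) q(1), where M = "{#{p,r}, {q,s}#} + mset w"])
        (use * p(2,3) q(2,3) assms(5) in auto)
    also have "\<dots> = Q ({p,r} # {q,s} # {q,s} # f # g # w)"
      by (rule Q_adj_sq[OF assms(1) q' refl, where M = "{#{p,r}, f#} + mset w"])
        (use * q(2,3) assms(5) in auto)
    finally have "\<not> eps (f # g # w) p r q s" by (simp add: eps_def)
    then show ?thesis using eps_sym[OF assms(1) quad qd set] by simp
  qed
qed

lemma Q_sq:
  assumes "5 \<le> d" "mset xs = {#e,e,f#} + M" "mset ys = {#e,f,f#} + M"
  shows "Q xs = Q ys"
proof (cases "e = f \<or> length xs \<noteq> d \<or> \<not> set xs \<subseteq> edges")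
  case True
  have "set xs = insert e (insert f (set_mset M))"
    using arg_cong[OF assms(2), of set_mset] by simp
  also have "\<dots> = set ys"
    using arg_cong[OF assms(3), of set_mset] by auto
  finally have "set xs = set ys" .
  moreover have "length xs = length ys" using assms(2,3) by (metis size_mset size_union size_add_mset)
  ultimately show ?thesis using True length_Q edges_Q assms Q_mset[of xs ys] by auto
next
  case False
  have d: "4 \<le> d" using assms by simp
  obtain w where w: "mset w = M" using ex_mset by blast
  have "set_mset (mset xs) = insert e (insert f (set w))" unfolding assms(2) using w by auto
  then have xs: "set xs = insert e (insert f (set w))" by simp
  have "size (mset xs) = size {#e,e,f#} + size M" unfolding assms(2) by (rule size_union)
  then have "length w + 3 = d" using False w by auto
  then obtain g h w' where w': "w = g # h # w'" using assms(1) by (cases w; cases "tl w") auto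
  have ef: "e \<in> edges" "f \<in> edges" "e \<noteq> f" and gh: "g \<in> edges" "h \<in> edges"
    using False xs w' by auto
  have X: "Q xs = Q (e # e # f # w)" "Q ys = Q (e # f # f # w)"
    by (rule Q_mset[OF d], use assms w in simp)+
  from ef show ?thesis
  proof (cases rule: edges_cases)
    case (1 v x y)
    then show ?thesis using Q_adj_sq[OF d] assms by blast
  next
    case (2 v x y z)
    obtain cs where cs: "distinct ([v,x,y,z] @ cs)" "set cs \<subseteq> {..<5}" "length cs = 5 - length [v,x,y,z]"
      by (rule others[of "[v,x,y,z]"]) (use 2 in \<open>auto simp: quad_def\<close>)
    then obtain a where "cs = [a]" by (auto simp: numeral_eq_Suc length_Suc_conv)
    then have a: "distinct [a,v,x,y,z]" "a < 5" using cs by auto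
    have "\<not> eps w v x y z" unfolding w' by (rule eps_two[OF d gh a]) (use 2 in \<open>auto simp: quad_def\<close>)
    then show ?thesis using X 2 by (simp add: eps_def)
  qed
qed

lemma Q_set:
  assumes d: "5 \<le> d" and "set xs = set ys" "length xs = length ys"
  shows "Q xs = Q ys"
proof (cases "xs = []")
  case True then show ?thesis using assms by auto
next
  case False
  obtain g where g: "set g = set xs" "distinct g" using finite_distinct_list[of "set xs"] by auto
  with False obtain x g' where g': "g = x # g'" by (cases g) auto
  have fill: "Q (g @ replicate k x @ r) = Q (g @ replicate (k + length r) x)"
    if "set r \<subseteq> set g" for k r using that
  proof (induction r arbitrary: k)
    case (Cons y r)
    have "Q (g @ replicate k x @ y # r) = Q (g @ replicate (Suc k) x @ r)"
    proof (cases "y = x")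
      case True
      show ?thesis by (rule Q_mset) (use True d in auto)
    next
      case False
      with Cons.prems g' have "y \<in> set g'" by auto
      then obtain p s where "g' = p @ y # s" by (meson split_list)
      then show ?thesis using g'
        by (intro Q_sq[OF d, of _ y x "mset p + mset s + replicate_mset k x + mset r"]) auto
    qed
    also have "\<dots> = Q (g @ replicate (k + length (y # r)) x)"
      using Cons.IH[of "Suc k"] Cons.prems by simp
    finally show ?case .
  qed simp
  have canon: "Q zs = Q (g @ replicate (length zs - length g) x)" if "set zs = set g" for zs
  proof -
    have "mset g \<subseteq># mset zs"
      using g(2) that by (metis mset_set_set mset_set_set_mset_msubset set_mset_mset)
    then obtain r where r: "mset zs = mset g + mset r"
      by (metis ex_mset subset_mset.add_diff_inverse)
    then have "length zs = length g + length r" by (metis size_mset size_union)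
    moreover have "set r \<subseteq> set g" using arg_cong[OF r, of set_mset] that by auto
    moreover have "Q zs = Q (g @ r)" using r d by (intro Q_mset) auto
    ultimately show ?thesis using fill[of r 0] by simp
  qed
  show ?thesis using canon[of xs] canon[of ys] assms g by simp
qed

lemma graph_plucker_nonempty:
  assumes d: "5 \<le> d" and "quad v x y z" "finite H" "H \<noteq> {}" "card H \<le> d - 2"
    and "length xs = d" "length ys = d" "length zs = d"
    and "set xs = H \<union> {{v,x},{y,z}}" "set ys = H \<union> {{v,y},{x,z}}" "set zs = H \<union> {{v,z},{x,y}}"
  shows "Q xs = (Q ys \<noteq> Q zs)"
proof -
  obtain h where h: "set h = H" "distinct h" using finite_distinct_list[OF assms(3)] by blast
  then have l: "length h \<le> d - 2" using assms(5) distinct_card[OF h(2)] by simp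
  define u where "u = h @ replicate (d - 2 - length h) (hd h)"
  have "hd h \<in> set h" using assms(4) h by (intro hd_in_set) auto
  then have u: "set u = H" "length u = d - 2" using h l by (auto simp: u_def)
  have "Q xs = Q (u @ {v,x} # {y,z} # [])" "Q ys = Q (u @ {v,y} # {x,z} # [])"
    "Q zs = Q (u @ {v,z} # {x,y} # [])"
    by (rule Q_set[OF d]; use d in \<open>simp add: u assms(6-11)\<close>)+
  then show ?thesis using plu[OF assms(2), of u "[]"] by simp
qed

lemma graph_plucker:
  assumes d: "5 \<le> d" and q: "quad v x y z" and "finite H" "card H \<le> d - 2"
    and "length xs = d" "length ys = d" "length zs = d"
    and "set xs = H \<union> {{v,x},{y,z}}" "set ys = H \<union> {{v,y},{x,z}}" "set zs = H \<union> {{v,z},{x,y}}"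
  shows "Q xs = (Q ys \<noteq> Q zs)"
proof (cases "H = {}")
  case False
  then show ?thesis by (rule graph_plucker_nonempty[OF d q assms(3) _ assms(4-10)])
next
  case True
  \<comment> \<open>Take \<open>H\<close> to be each of the three matchings in turn and add up: the mixed terms cancel.\<close>
  define M where "M = [[{v,x},{y,z}], [{v,y},{x,z}], [{v,z},{x,y}]]"
  define W where "W i j = M!i @ M!j @ replicate (d - 4) (hd (M!i))" for i j
  have W: "length (W i j) = d" "set (W i j) = set (M!i) \<union> set (M!j)" if "i < 3" "j < 3" for i j
    using that d by (auto simp: W_def M_def less_Suc_eq numeral_eq_Suc)
  have c: "card (set (M!i)) \<le> d - 2" "set (M!i) \<noteq> {}" if "i < 3" for i
    using that d card_length[of "M!i"] by (auto simp: M_def less_Suc_eq numeral_eq_Suc)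
  have rel: "Q (W i 0) = (Q (W i 1) \<noteq> Q (W i 2))" if "i < 3" for i
    by (rule graph_plucker_nonempty[OF d q _ c(2,1)[OF that]])
      (use that in \<open>simp_all add: W\<close>, simp_all add: M_def)
  have sym: "Q (W i j) = Q (W j i)" if "i < 3" "j < 3" for i j
    by (rule Q_set[OF d]) (use that W in auto)
  have "Q xs = Q (W 0 0)" "Q ys = Q (W 1 1)" "Q zs = Q (W 2 2)"
    by (rule Q_set[OF d]; use assms True W in \<open>simp add: M_def\<close>)+
  then show ?thesis using rel[of 0] rel[of 1] rel[of 2] sym[of 0 1] sym[of 0 2] sym[of 1 2] by simp argo
qed

end

section \<open>Hit relations between words\<close>

interpretation V: vector_space scl
  by unfold_locales (auto simp: scl_def algebra_simps fun_eq_iff)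

lemma poly_add_self [simp]: "(f :: Defs.poly) + f = 0"
  by (rule ext) simp

lemma sum_apply: "(\<Sum>x\<in>A. f x) c = (\<Sum>x\<in>A. f x c)"
  for f :: "'a \<Rightarrow> 'b \<Rightarrow> 'c::comm_monoid_add"
  by (induction A rule: infinite_finite_induct) auto

lemma of_nat_bit: "(of_nat n :: bit) = (if odd n then 1 else 0)"
  by (induction n) auto

lemma in_span_monomials:
  assumes "finite {b. f b \<noteq> 0}" "\<And>b. f b \<noteq> 0 \<Longrightarrow> P b"
  shows "f \<in> span2 {monomial a | a. P a}"
proof -
  have "f = (\<Sum>b | f b \<noteq> 0. monomial b)"
  proof
    fix c
    have "(\<Sum>b | f b \<noteq> 0. monomial b) c = (\<Sum>b | f b \<noteq> 0. if b = c then 1 else 0)"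
      by (auto simp: sum_apply monomial_def intro!: sum.cong)
    then show "f c = (\<Sum>b | f b \<noteq> 0. monomial b) c"
      using assms(1) by (cases "f c") auto
  qed
  moreover have "(\<Sum>b | f b \<noteq> 0. monomial b) \<in> span2 {monomial a | a. P a}"
    using assms(2) by (intro V.span_sum V.span_base) auto
  ultimately show ?thesis by simp
qed

lemma choose_double:
  "odd ((2 * m) choose (2 * k)) = odd (m choose k) \<and> even ((2 * m) choose (Suc (2 * k)))"
proof (induction m arbitrary: k)
  case 0
  show ?case by (cases k) auto
next
  case (Suc m)
  have two: "Suc (Suc n) choose Suc (Suc j) = (n choose j) + 2 * (n choose Suc j) + (n choose Suc (Suc j))" for n j
    by simp
  show ?case
  proof (cases k)
    case (Suc k')
    then show ?thesis
      using two[of "2 * m" "2 * k'"] two[of "2 * m" "Suc (2 * k')"] Suc.IH[of k'] Suc.IH[of "Suc k'"]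
      by (auto simp del: binomial_Suc_Suc simp: binomial_Suc_Suc[of m k'])
  qed simp
qed

lemma choose_double_parity:
  "odd ((2 * m) choose (2 * k)) = odd (m choose k)"
  "even ((2 * m) choose (Suc (2 * k)))"
  "odd (Suc (2 * m) choose (2 * k)) = odd (m choose k)"
  using choose_double[of m k] choose_double[of m "k - 1"] by (cases k; simp)+

definition level :: "nat set \<Rightarrow> expv \<Rightarrow> expv" where
  "level e b = (\<lambda>j. (if j < 5 \<and> j \<notin> e then 1 else 0) + 2 * b j)"

abbreviation levels :: "nat set list \<Rightarrow> expv \<Rightarrow> expv" where
  "levels u b \<equiv> foldr level u b"

abbreviation expo :: "nat set list \<Rightarrow> expv" where
  "expo w \<equiv> levels w (\<lambda>_. 0)"

lemma level_in: "j < 5 \<Longrightarrow> j \<notin> e \<Longrightarrow> level e b j = Suc (2 * b j)"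
  and level_out: "\<not> (j < 5 \<and> j \<notin> e) \<Longrightarrow> level e b j = 2 * b j"
  by (auto simp: level_def)

lemma odd_level: "odd (level e b j) \<longleftrightarrow> j < 5 \<and> j \<notin> e"
  by (simp add: level_def)

lemma level_div_2: "level e b j div 2 = b j"
  by (simp add: level_def)

lemma mono5_level [simp]: "mono5 (level e b) = mono5 b"
  by (auto simp: mono5_def level_def)

lemma mono5_levels [simp]: "mono5 (levels u b) = mono5 b"
  by (induction u) auto

lemma mono5_zero [simp]: "mono5 (\<lambda>_. 0)" by (simp add: mono5_def)

lemma weight_0: "weight a 0 = card {j. j < 5 \<and> odd (a j)}"
proof -
  have "weight a 0 = (\<Sum>j<5. if odd (a j) then 1 else 0)"
    unfolding weight_def by (intro sum.cong) (auto simp: odd_iff_mod_2_eq_one)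
  also have "\<dots> = (\<Sum>j\<in>{j. j < 5 \<and> odd (a j)}. 1)"
    by (subst sum.inter_filter[symmetric]) (auto simp: lessThan_def)
  finally show ?thesis by simp
qed

lemma weight_Suc: "weight a (Suc i) = weight (\<lambda>j. a j div 2) i"
  by (simp add: weight_def div_mult2_eq)

lemma weight_level_Suc [simp]: "weight (level e b) (Suc i) = weight b i"
  by (simp add: weight_Suc level_div_2)

lemma weight_level_0 [simp]: "weight (level e b) 0 = card ({..<5} - e)"
  unfolding weight_0 by (rule arg_cong[where f = card]) (auto simp: odd_level)

lemma card_edge_compl [simp]: "e \<in> edges \<Longrightarrow> card ({..<5} - e) = 3"
  by (auto simp: edges_def card_Diff_subset)

lemma wless_0: "weight a 0 < 3 \<Longrightarrow> 0 < d \<Longrightarrow> wless (weight a) (three_d d)"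
  unfolding wless_def three_d_def by (intro exI[of _ 0]) auto

lemma wless_Suc:
  assumes "weight a 0 = 3" "wless (weight (\<lambda>j. a j div 2)) (three_d d)"
  shows "wless (weight a) (three_d (Suc d))"
proof -
  obtain i where i: "\<forall>j<i. weight (\<lambda>j. a j div 2) j = three_d d j" "weight (\<lambda>j. a j div 2) i < three_d d i"
    using assms(2) by (auto simp: wless_def)
  show ?thesis unfolding wless_def
  proof (intro exI[of _ "Suc i"] conjI allI impI)
    fix j assume "j < Suc i"
    then show "weight a j = three_d (Suc d) j"
      using assms(1) i(1) by (cases j) (auto simp: weight_Suc three_d_def)
  qed (use i(2) in \<open>auto simp: weight_Suc three_d_def\<close>)
qed

lemma wless_levels:
  assumes "set u \<subseteq> edges" "wless (weight b) (three_d d)"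
  shows "wless (weight (levels u b)) (three_d (length u + d))"
  using assms(1)
proof (induction u)
  case Nil
  show ?case using assms by simp
next
  case (Cons e u)
  then show ?case using wless_Suc[of "level e (levels u b)" "length u + d"] by (simp add: level_div_2)
qed

lemma mdeg_level: "mdeg (level e b) = card ({..<5} - e) + 2 * mdeg b"
proof -
  have "(\<Sum>j<5. if j < 5 \<and> j \<notin> e then 1 else 0) = (\<Sum>j\<in>{..<5} - e. (1::nat))"
    by (rule sum.mono_neutral_cong_right) auto
  then show ?thesis by (simp add: mdeg_def level_def sum.distrib sum_distrib_left)
qed

lemma mdeg_levels: "set u \<subseteq> edges \<Longrightarrow> mdeg (levels u b) = 3 * (2 ^ length u - 1) + 2 ^ length u * mdeg b"
proof (induction u)
  case (Cons e u)
  obtain q :: nat where "2 ^ length u = Suc q" by (metis not0_implies_Suc power_not_zero zero_neq_numeral)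
  then show ?case using Cons by (simp add: mdeg_level algebra_simps)
qed simp

lemma deg_three_d: "deg_three_d d = 3 * (2 ^ d - 1)"
proof (induction d)
  case (Suc d)
  have "deg_three_d (Suc d) = deg_three_d d + 2 ^ d * 3"
    by (simp add: deg_three_d_def wdeg_def three_d_def)
  moreover have "(1::nat) \<le> 2 ^ d" by simp
  ultimately show ?case using Suc by (simp add: algebra_simps)
qed (simp add: deg_three_d_def wdeg_def)

lemma weight_expo:
  assumes "set w \<subseteq> edges"
  shows "weight (expo w) = three_d (length w)"
proof
  show "weight (expo w) i = three_d (length w) i" for i using assms
  proof (induction w arbitrary: i)
    case Nil
    show ?case by (simp add: weight_def three_d_def)
  next
    case (Cons e w)
    then show ?case by (cases i) (auto simp: three_d_def)
  qed
qed

lemma ex_expo: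
  assumes "mono5 a" "weight a = three_d d"
  shows "\<exists>w. length w = d \<and> set w \<subseteq> edges \<and> a = expo w"
  using assms
proof (induction d arbitrary: a)
  case 0
  have "a j = 0" for j
  proof (cases "j < 5")
    case True
    have "a j div 2 ^ i mod 2 = 0" for i
    proof -
      have "weight a i = 0" using 0 by (simp add: three_d_def)
      then show ?thesis using True unfolding weight_def by (simp only: sum_eq_0_iff finite_lessThan) auto
    qed
    then show ?thesis by (intro bit_eqI) (simp add: bit_iff_odd even_iff_mod_2_eq_zero)
  qed (use 0 in \<open>auto simp: mono5_def\<close>)
  then show ?case by (auto simp: fun_eq_iff)
next
  case (Suc d)
  define e where "e = {j. j < 5 \<and> even (a j)}"
  have a: "a = level e (\<lambda>j. a j div 2)"
  proof
    show "a j = level e (\<lambda>j. a j div 2) j" for j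
      using Suc.prems(1) by (auto simp: level_def e_def mono5_def not_less)
  qed
  have "mono5 (\<lambda>j. a j div 2)" using Suc.prems(1) by (auto simp: mono5_def)
  moreover have "weight (\<lambda>j. a j div 2) = three_d d"
  proof
    show "weight (\<lambda>j. a j div 2) i = three_d d i" for i
      using fun_cong[OF Suc.prems(2), of "Suc i"] by (simp add: weight_Suc three_d_def)
  qed
  ultimately obtain w where w: "length w = d" "set w \<subseteq> edges" "(\<lambda>j. a j div 2) = expo w"
    using Suc.IH by blast
  have "card {j. j < 5 \<and> odd (a j)} = 3"
    using fun_cong[OF Suc.prems(2), of 0] by (simp add: weight_0 three_d_def)
  moreover have "{..<5} = e \<union> {j. j < 5 \<and> odd (a j)}" "e \<inter> {j. j < 5 \<and> odd (a j)} = {}"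
    by (auto simp: e_def)
  moreover have "finite e" "card {..<5::nat} = 5" by (simp_all add: e_def)
  ultimately have "card e = 2"
    using card_Un_disjoint[of e "{j. j < 5 \<and> odd (a j)}"] by simp
  then obtain x y where "e = {x,y}" "x \<noteq> y" by (auto simp: card_2_iff)
  moreover have "e \<subseteq> {..<5}" by (auto simp: e_def)
  ultimately have "e \<in> edges" by (auto simp: edges_def)
  then show ?case using a w by (intro exI[of _ "e # w"]) auto
qed

text \<open>Every term of \<open>Sq\<close> that adds an odd amount to some digit position below \<open>length u\<close> lowers the weight
  there, so only the terms that carry the whole \<open>2\<close>-power past \<open>u\<close> in one variable survive.\<close>
lemma Sq_level_term:
  assumes "set u \<subseteq> edges" "length u \<le> d" "mono5 b"
    and "\<And>j. levels u b j \<le> c j" "mono5 c" "(\<Sum>j<5. c j - levels u b j) = 2 ^ length u"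
    and "\<And>j. j < 5 \<Longrightarrow> odd (levels u b j choose (c j - levels u b j))"
  shows "(\<exists>j<5. odd (b j) \<and> c = levels u (b(j := Suc (b j)))) \<or> wless (weight c) (three_d d)"
  using assms
proof (induction u arbitrary: c d)
  case Nil
  have "(\<Sum>j<5. c j - b j) = 1" using Nil.prems(6) by simp
  then obtain j where j: "j < 5" "c j - b j = 1" "\<And>i. i < 5 \<Longrightarrow> i \<noteq> j \<Longrightarrow> c i - b i = 0"
    unfolding sum_eq_1_iff[OF finite_lessThan] by (metis lessThan_iff)
  have "c = b(j := Suc (b j))"
  proof
    fix i
    show "c i = (b(j := Suc (b j))) i"
      using j(1,2) j(3)[of i] Nil.prems(3,5) Nil.prems(4)[of i] by (cases "i < 5"; cases "i = j") (auto simp: mono5_def)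
  qed
  moreover have "odd (b j)" using Nil.prems(7)[OF j(1)] j(2) by simp
  ultimately show ?case using j(1) by auto
next
  case (Cons e u)
  let ?a = "levels u b"
  have ce: "e \<in> edges" using Cons.prems by simp
  define k where "k j = c j - level e ?a j" for j
  have k: "c j = level e ?a j + k j" for j using Cons.prems(4)[of j] by (simp add: k_def)
  have ka: "odd (level e ?a j choose k j)" if "j < 5" for j
    using Cons.prems(7)[OF that] by (simp add: k_def)
  obtain d' where d: "d = Suc d'" using Cons.prems(2) by (cases d) auto
  show ?case
  proof (cases "\<exists>j<5. odd (k j)")
    case True
    have o: "odd (level e ?a j)" if "j < 5" "odd (k j)" for j
      using ka[OF that(1)] that choose_double_parity(2)[of "level e ?a j div 2" "k j div 2"] by auto
    have "{j. j < 5 \<and> odd (c j)} \<subset> {..<5} - e"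
    proof
      show "{j. j < 5 \<and> odd (c j)} \<subseteq> {..<5} - e"
      proof
        fix j assume "j \<in> {j. j < 5 \<and> odd (c j)}"
        then have "odd (level e ?a j)" using k[of j] o[of j] by (cases "odd (k j)") auto
        then show "j \<in> {..<5} - e" by (simp add: odd_level)
      qed
      obtain j where j: "j < 5" "odd (k j)" using True by auto
      then have "even (c j)" "j \<in> {..<5} - e" using k[of j] o[of j] by (auto simp: odd_level)
      then show "{j. j < 5 \<and> odd (c j)} \<noteq> {..<5} - e" by auto
    qed
    then have "weight c 0 < 3"
      unfolding weight_0 using psubset_card_mono[of "{..<5} - e" "{j. j < 5 \<and> odd (c j)}"] ce by simp
    then show ?thesis using wless_0 d by simp
  next
    case False
    define c' where "c' j = ?a j + k j div 2" for j
    have kz: "k j = 0" if "\<not> j < 5" for j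
      using Cons.prems(5) k[of j] that by (auto simp: mono5_def)
    have ev: "even (k j)" for j using False kz by (cases "j < 5") auto
    have c: "c = level e c'"
    proof
      show "c j = level e c' j" for j using k[of j] ev[of j]
        by (cases "j < 5 \<and> j \<notin> e") (simp_all add: level_in level_out c'_def)
    qed
    have "(\<exists>j<5. odd (b j) \<and> c' = levels u (b(j := Suc (b j)))) \<or> wless (weight c') (three_d d')"
    proof (rule Cons.IH)
      show "mono5 c'" using Cons.prems(3,5) kz unfolding c by simp
      have "(\<Sum>j<5. 2 * (c' j - ?a j)) = (\<Sum>j<5. c j - level e ?a j)"
        using ev by (intro sum.cong) (auto simp: c'_def k_def[symmetric])
      then show "(\<Sum>j<5. c' j - ?a j) = 2 ^ length u"
        using Cons.prems(6) by (simp add: sum_distrib_left[symmetric])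
      fix j :: nat assume j: "j < 5"
      have "odd (level e ?a j choose (2 * (k j div 2)))" using ka[OF j] ev[of j] by simp
      then have "odd (?a j choose (k j div 2))"
        using choose_double_parity(1,3)[of "?a j" "k j div 2"] 
        by (cases "j < 5 \<and> j \<notin> e") (simp_all add: level_in level_out del: binomial_Suc_Suc)
      then show "odd (?a j choose (c' j - ?a j))" by (simp add: c'_def)
    qed (use Cons.prems d in \<open>auto simp: c'_def\<close>)
    then show ?thesis
    proof
      assume "\<exists>j<5. odd (b j) \<and> c' = levels u (b(j := Suc (b j)))"
      then obtain j where "j < 5" "odd (b j)" "c' = levels u (b(j := Suc (b j)))" by blast
      then show ?thesis using c by (intro disjI1 exI[of _ j]) (simp add: fun_upd_def)
    next
      assume "wless (weight c') (three_d d')"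
      then show ?thesis using wless_Suc[of c d'] c ce d by (simp add: level_div_2)
    qed
  qed
qed

lemma levels_upd: "levels u (b(j := Suc (b j))) i = levels u b i + (if i = j then 2 ^ length u else 0)"
proof (induction u)
  case (Cons e u)
  then show ?case by (cases "i < 5 \<and> i \<notin> e") (simp_all add: level_in level_out)
qed simp

lemma choose_levels: "odd (levels u b j choose (2 ^ length u)) = odd (b j)"
proof (induction u)
  case (Cons e u)
  then show ?case
    using choose_double_parity(1,3)[of "levels u b j" "2 ^ length u"]
    by (cases "j < 5 \<and> j \<notin> e") (simp_all add: level_in level_out del: binomial_Suc_Suc)
qed simp

lemma finite_degree: "finite {c. mono5 c \<and> mdeg c = n}"
proof (rule finite_subset)
  show "{c. mono5 c \<and> mdeg c = n} \<subseteq>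
    {c. \<forall>j. (j \<in> {..<5} \<longrightarrow> c j \<in> {..n}) \<and> (j \<notin> {..<5} \<longrightarrow> c j = 0)}"
  proof clarify
    fix c :: expv and j
    assume "mono5 c"
    then show "(j \<in> {..<5} \<longrightarrow> c j \<in> {..mdeg c}) \<and> (j \<notin> {..<5} \<longrightarrow> c j = 0)"
      using member_le_sum[of j "{..<5}" c] by (auto simp: mono5_def mdeg_def)
  qed
  show "finite {c. \<forall>j. (j \<in> {..<5} \<longrightarrow> c j \<in> {..n}) \<and> (j \<notin> {..<5::nat} \<longrightarrow> c j = 0)}"
    by (rule finite_set_of_finite_funs) auto
qed

lemma Sq_levels:
  assumes u: "set u \<subseteq> edges" "length u \<le> d" and b: "mono5 b"
    and deg: "mdeg (levels u b) + 2 ^ length u = deg_three_d d"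
  shows "Sq (2 ^ length u) (levels u b) + (\<Sum>j | j < 5 \<and> odd (b j). monomial (levels u (b(j := Suc (b j)))))
    \<in> Pw_minus d"
proof -
  let ?a = "levels u b" and ?k = "2 ^ length u :: nat"
  let ?J = "{j. j < 5 \<and> odd (b j)}"
  define f where "f = Sq ?k ?a + (\<Sum>j\<in>?J. monomial (levels u (b(j := Suc (b j)))))"
  have inj: "i = j" if "levels u (b(i := Suc (b i))) = levels u (b(j := Suc (b j)))" for i j
    using fun_cong[OF that, of i] by (simp add: levels_upd split: if_splits)
  have Sq1: "Sq ?k ?a (levels u (b(j := Suc (b j)))) = 1" if "j \<in> ?J" for j
  proof -
    have "(\<Sum>i<5. levels u (b(j := Suc (b j))) i - ?a i) = (\<Sum>i<5. if i = j then ?k else 0)"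
      by (intro sum.cong) (simp_all add: levels_upd)
    also have "\<dots> = ?k" using that by simp
    finally have 1: "(\<Sum>i<5. levels u (b(j := Suc (b j))) i - ?a i) = ?k" .
    have 2: "odd (?a i choose (levels u (b(j := Suc (b j))) i - ?a i))" for i
      using choose_levels[of u b i] that by (cases "i = j") (auto simp: levels_upd)
    have "odd (\<Prod>i<5. ?a i choose (levels u (b(j := Suc (b j))) i - ?a i))"
      using 2 by (subst even_prod_iff) auto
    moreover have "\<forall>i\<ge>5. levels u (b(j := Suc (b j))) i = ?a i"
      using that by (auto simp: levels_upd)
    moreover have "\<forall>i. ?a i \<le> levels u (b(j := Suc (b j))) i" by (simp add: levels_upd)
    ultimately show ?thesis using 1 unfolding Sq_def by (simp add: of_nat_bit)
  qed
  have f: "mono5 c \<and> mdeg c = deg_three_d d \<and> wless (weight c) (three_d d)" if "f c \<noteq> 0" for c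
  proof -
    have nt: "c \<noteq> levels u (b(j := Suc (b j)))" if j: "j \<in> ?J" for j
    proof
      assume c: "c = levels u (b(j := Suc (b j)))"
      have "(\<Sum>i\<in>?J. monomial (levels u (b(i := Suc (b i)))) c) = (\<Sum>i\<in>?J. if i = j then 1 else 0)"
        unfolding c monomial_def using inj by (intro sum.cong) auto
      then have "f c = 0" using j Sq1[OF j] c by (simp add: f_def sum_apply)
      with \<open>f c \<noteq> 0\<close> show False ..
    qed
    then have "(\<Sum>j\<in>?J. monomial (levels u (b(j := Suc (b j)))) c) = 0"
      unfolding monomial_def by (intro sum.neutral) auto
    then have nz: "Sq ?k ?a c \<noteq> 0" using that by (simp add: f_def sum_apply)
    then have *: "\<And>j. ?a j \<le> c j" "\<And>j. j \<ge> 5 \<Longrightarrow> c j = ?a j" "(\<Sum>j<5. c j - ?a j) = ?k"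
      "odd (\<Prod>j<5. ?a j choose (c j - ?a j))"
      unfolding Sq_def by (auto split: if_splits simp: of_nat_bit)
    have "mono5 ?a" using b by simp
    then have c5: "mono5 c" using *(2) unfolding mono5_def by auto
    have "(\<exists>j<5. odd (b j) \<and> c = levels u (b(j := Suc (b j)))) \<or> wless (weight c) (three_d d)"
      by (rule Sq_level_term[OF u b *(1) c5 *(3)]) (use *(4) in \<open>auto simp: even_prod_iff\<close>)
    then have "wless (weight c) (three_d d)" using nt by auto
    moreover have "mdeg c = mdeg ?a + ?k"
      unfolding mdeg_def *(3)[symmetric] sum.distrib[symmetric] using *(1) by (intro sum.cong) auto
    ultimately show ?thesis using c5 deg by simp
  qed
  have "finite {c. mono5 c \<and> mdeg c = deg_three_d d}" by (rule finite_degree)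
  then have "finite {c. f c \<noteq> 0}" by (rule rev_finite_subset) (use f in auto)
  then have "f \<in> Pw_minus d" unfolding Pw_minus_def by (rule in_span_monomials) (use f in auto)
  then show ?thesis by (simp add: f_def)
qed

lemma subspace_Kw: "V.subspace (Kw d)"
  unfolding Kw_def Pw_def by (intro V.subspace_inter V.subspace_span)

lemma word_in_Pw:
  assumes "set w \<subseteq> edges" "length w = d"
  shows "monomial (expo w) \<in> Pw d"
proof -
  have "mdeg (expo w) = deg_three_d d"
    using mdeg_levels[OF assms(1), of "\<lambda>_. 0"] assms(2) by (simp add: deg_three_d mdeg_def)
  then show ?thesis unfolding Pw_def using assms weight_expo[OF assms(1)]
    by (intro V.span_base) auto
qed

lemma sum_in_Kw:
  assumes u: "set u \<subseteq> edges" "length u \<le> d" and b: "mono5 b"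
    and deg: "mdeg (levels u b) + 2 ^ length u = deg_three_d d"
    and G: "G \<subseteq> {j. j < 5 \<and> odd (b j)}"
    and Pw: "\<And>j. j \<in> G \<Longrightarrow> monomial (levels u (b(j := Suc (b j)))) \<in> Pw d"
    and less: "\<And>j. j < 5 \<Longrightarrow> odd (b j) \<Longrightarrow> j \<notin> G \<Longrightarrow> wless (weight (levels u (b(j := Suc (b j))))) (three_d d)"
  shows "(\<Sum>j\<in>G. monomial (levels u (b(j := Suc (b j))))) \<in> Kw d"
proof -
  let ?J = "{j. j < 5 \<and> odd (b j)}" and ?S = "span2 (AplusP5 \<union> Pw_minus d)"
  let ?m = "\<lambda>j. monomial (levels u (b(j := Suc (b j))))"
  have fin: "finite ?J" by simp
  have "Sq (2 ^ length u) (levels u b) \<in> AplusP5"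
    unfolding AplusP5_def using b by (intro V.span_base) (auto intro!: exI)
  then have 1: "Sq (2 ^ length u) (levels u b) \<in> ?S" by (intro V.span_base) simp
  have 2: "Sq (2 ^ length u) (levels u b) + sum ?m ?J \<in> ?S"
    using Sq_levels[OF u b deg] by (intro V.span_base) simp
  have "sum ?m (?J - G) \<in> ?S"
  proof (intro V.span_sum V.span_base UnI2)
    fix j assume j: "j \<in> ?J - G"
    have "(\<Sum>i<5. levels u (b(j := Suc (b j))) i) = (\<Sum>i<5. levels u b i) + (\<Sum>i<5. if i = j then 2 ^ length u else 0)"
      by (simp only: levels_upd sum.distrib)
    then have "mdeg (levels u (b(j := Suc (b j)))) = deg_three_d d"
      using j deg by (simp add: mdeg_def)
    moreover have "mono5 (b(j := Suc (b j)))" using b j by (auto simp: mono5_def)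
    ultimately show "?m j \<in> Pw_minus d" unfolding Pw_minus_def using j less
      by (intro V.span_base) auto
  qed
  then have "(Sq (2 ^ length u) (levels u b) + (Sq (2 ^ length u) (levels u b) + sum ?m ?J)) + sum ?m (?J - G) \<in> ?S"
    by (rule V.span_add[OF V.span_add[OF 1 2]])
  moreover have "(Sq (2 ^ length u) (levels u b) + (Sq (2 ^ length u) (levels u b) + sum ?m ?J)) + sum ?m (?J - G)
      = (Sq (2 ^ length u) (levels u b) + Sq (2 ^ length u) (levels u b)) +
      (sum ?m (?J - G) + sum ?m (?J - G)) + sum ?m G"
    unfolding sum.subset_diff[OF G fin, of ?m] by (simp only: ac_simps)
  ultimately have "sum ?m G \<in> ?S" by (simp only: poly_add_self add_0_left)
  moreover have "sum ?m G \<in> Pw d" unfolding Pw_def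
    by (intro V.span_sum) (use Pw in \<open>simp add: Pw_def\<close>)
  ultimately show ?thesis by (simp add: Kw_def)
qed

lemma level_upd_in:
  "j < 5 \<Longrightarrow> j \<notin> e \<Longrightarrow> (level e b)(j := Suc (level e b j)) = level (insert j e) (b(j := Suc (b j)))"
  by (rule ext) (auto simp: level_def)

lemma level_upd_out:
  "j < 5 \<Longrightarrow> j \<in> e \<Longrightarrow> (level e b)(j := Suc (level e b j)) = level (e - {j}) b"
  by (rule ext) (auto simp: level_def)

lemma wless_level_0:
  assumes "card ({..<5} - e) < 3" "0 < d"
  shows "wless (weight (level e b)) (three_d d)"
  using assms by (intro wless_0) auto

lemma edges_Diff:
  assumes "C \<subseteq> {..<5}" "card C = 3" "j \<in> C"
  shows "C - {j} \<in> edges"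
proof -
  have "card (C - {j}) = 2" using assms by (simp add: card_Diff_singleton)
  then obtain x y where "C - {j} = {x,y}" "x \<noteq> y" by (auto simp: card_2_iff)
  then show ?thesis using assms(1) by (auto intro!: edgesI)
qed

lemma card_compl_insert:
  assumes "C \<subseteq> {..<5::nat}" "card C = 3" "j < 5" "j \<notin> C"
  shows "card ({..<5} - insert j C) < 3"
  using assms finite_subset[OF assms(1)] by (subst card_Diff_subset) auto

lemma mdeg_vertex_levels:
  assumes "v < 5" "C \<subseteq> {..<5}" "card C = 3"
  shows "mdeg (level {v} b) = 4 + 2 * mdeg b" "mdeg (level C b) = 2 + 2 * mdeg b"
proof -
  have "finite C" using assms(2) by (rule finite_subset) simp
  then show "mdeg (level {v} b) = 4 + 2 * mdeg b" "mdeg (level C b) = 2 + 2 * mdeg b"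
    using assms by (simp_all add: mdeg_level card_Diff_subset)
qed

lemma relation_two:
  assumes "set u \<subseteq> edges" "set w \<subseteq> edges" "length u + length w + 2 = d"
    and v: "v < 5" and C: "C \<subseteq> {..<5}" "card C = 3"
  shows "(\<Sum>j\<in>C - {v}. monomial (expo (u @ {v,j} # (C - {j}) # w))) \<in> Kw d"
proof -
  define b where "b = expo ({v} # C # w)"
  have b: "b = level {v} (level C (expo w))" by (simp add: b_def)
  have upd: "b(j := Suc (b j)) = level {v,j} ((level C (expo w))(j := Suc (level C (expo w) j)))"
    if "j < 5" "j \<noteq> v" for j
    using that unfolding b by (subst level_upd_in) (auto simp: insert_commute)
  have mono: "levels u (b(j := Suc (b j))) = expo (u @ {v,j} # (C - {j}) # w)" if "j \<in> C - {v}" for j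
    using that C by (subst upd) (auto simp: level_upd_out)
  have "(\<Sum>j\<in>C - {v}. monomial (levels u (b(j := Suc (b j))))) \<in> Kw d"
  proof (rule sum_in_Kw)
    show "mdeg (levels u b) + 2 ^ length u = deg_three_d d"
    proof -
      obtain p q :: nat where pq: "2 ^ length u = Suc p" "2 ^ length w = Suc q"
        by (metis not0_implies_Suc power_not_zero zero_neq_numeral)
      then have "2 ^ d = 4 * (Suc p * Suc q)" unfolding assms(3)[symmetric] by (simp add: power_add)
      moreover have "mdeg b = 8 + 12 * q"
        using mdeg_levels[OF assms(2), of "\<lambda>_. 0"] mdeg_vertex_levels[OF v C] pq
        by (simp add: b mdeg_def)
      ultimately show ?thesis
        using mdeg_levels[OF assms(1), of b] pq by (simp add: deg_three_d algebra_simps)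
    qed
    show "C - {v} \<subseteq> {j. j < 5 \<and> odd (b j)}" using C by (auto simp: b odd_level)
    show "monomial (levels u (b(j := Suc (b j)))) \<in> Pw d" if "j \<in> C - {v}" for j
      unfolding mono[OF that] using that assms C v edges_Diff[OF C, of j]
      by (intro word_in_Pw) (auto intro!: edgesI)
    fix j assume j: "j < 5" "odd (b j)" "j \<notin> C - {v}"
    then have j': "j \<noteq> v" "j \<notin> C" by (auto simp: b odd_level)
    then have e: "{v,j} \<in> edges" using j v by (intro edgesI) auto
    have "wless (weight (level (insert j C) ((expo w)(j := Suc (expo w j))))) (three_d (length w + 1))"
      by (rule wless_level_0[OF card_compl_insert[OF C]]) (use j j' in auto)
    then have "wless (weight (levels (u @ [{v,j}]) (level (insert j C) ((expo w)(j := Suc (expo w j))))))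
        (three_d (length (u @ [{v,j}]) + (length w + 1)))"
      using assms e by (intro wless_levels) auto
    then show "wless (weight (levels u (b(j := Suc (b j))))) (three_d d)"
      using j j' assms(3) by (simp add: upd level_upd_in algebra_simps)
  qed (use assms in \<open>auto simp: b\<close>)
  then show ?thesis using mono by simp
qed

lemma relation_three:
  assumes "set u \<subseteq> edges" "set w \<subseteq> edges" "length u + length w + 3 = d"
    and v: "v < 5" and C: "C \<subseteq> {..<5}" "card C = 3"
  shows "(\<Sum>j\<in>C - {v}. monomial (expo (u @ {v,j} # {v,j} # (C - {j}) # w))) \<in> Kw d"
proof -
  define b where "b = expo ({v} # {v} # C # w)"
  have b: "b = level {v} (level {v} (level C (expo w)))" by (simp add: b_def)
  have upd: "b(j := Suc (b j)) = level {v,j} (level {v,j} ((level C (expo w))(j := Suc (level C (expo w) j))))"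
    if "j < 5" "j \<noteq> v" for j
    using that unfolding b by (subst level_upd_in, simp_all, subst level_upd_in) (auto simp: insert_commute)
  have mono: "levels u (b(j := Suc (b j))) = expo (u @ {v,j} # {v,j} # (C - {j}) # w)" if "j \<in> C - {v}" for j
    using that C by (subst upd) (auto simp: level_upd_out)
  have "(\<Sum>j\<in>C - {v}. monomial (levels u (b(j := Suc (b j))))) \<in> Kw d"
  proof (rule sum_in_Kw)
    show "mdeg (levels u b) + 2 ^ length u = deg_three_d d"
    proof -
      obtain p q :: nat where pq: "2 ^ length u = Suc p" "2 ^ length w = Suc q"
        by (metis not0_implies_Suc power_not_zero zero_neq_numeral)
      then have "2 ^ d = 8 * (Suc p * Suc q)" unfolding assms(3)[symmetric] by (simp add: power_add)
      moreover have "mdeg b = 20 + 24 * q"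
        using mdeg_levels[OF assms(2), of "\<lambda>_. 0"] mdeg_vertex_levels[OF v C] pq
        by (simp add: b mdeg_def)
      ultimately show ?thesis
        using mdeg_levels[OF assms(1), of b] pq by (simp add: deg_three_d algebra_simps)
    qed
    show "C - {v} \<subseteq> {j. j < 5 \<and> odd (b j)}" using C by (auto simp: b odd_level)
    show "monomial (levels u (b(j := Suc (b j)))) \<in> Pw d" if "j \<in> C - {v}" for j
      unfolding mono[OF that] using that assms C v edges_Diff[OF C, of j]
      by (intro word_in_Pw) (auto intro!: edgesI)
    fix j assume j: "j < 5" "odd (b j)" "j \<notin> C - {v}"
    then have j': "j \<noteq> v" "j \<notin> C" by (auto simp: b odd_level)
    then have e: "{v,j} \<in> edges" using j v by (intro edgesI) auto
    have "wless (weight (level (insert j C) ((expo w)(j := Suc (expo w j))))) (three_d (length w + 1))"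
      by (rule wless_level_0[OF card_compl_insert[OF C]]) (use j j' in auto)
    then have "wless (weight (levels (u @ [{v,j}, {v,j}]) (level (insert j C) ((expo w)(j := Suc (expo w j))))))
        (three_d (length (u @ [{v,j}, {v,j}]) + (length w + 1)))"
      using assms e by (intro wless_levels) auto
    then show "wless (weight (levels u (b(j := Suc (b j))))) (three_d d)"
      using j j' assms(3)[symmetric] by (simp add: upd level_upd_in eval_nat_numeral)
  qed (use assms in \<open>auto simp: b\<close>)
  then show ?thesis using mono by simp
qed

lemma ex_functional:
  assumes K: "V.subspace K" and x: "x \<notin> K"
  obtains \<psi> :: "Defs.poly \<Rightarrow> bit" where "\<And>f g. \<psi> (f + g) = \<psi> f + \<psi> g" "\<And>f. f \<in> K \<Longrightarrow> \<psi> f = 0" "\<psi> x = 1"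
proof -
  obtain B where B: "B \<subseteq> K" "V.independent B" "K \<subseteq> V.span B" "card B = V.dim K"
    by (rule V.basis_exists)
  then have sp: "V.span B = K" using V.span_minimal[OF B(1) K] by (intro subset_antisym)
  then have ind: "V.independent (insert x B)" using B(2) x by (intro V.independent_insertI) simp_all
  obtain B' where B': "insert x B \<subseteq> B'" "B' \<subseteq> UNIV" "V.independent B'" "UNIV \<subseteq> V.span B'"
    by (rule V.maximal_independent_subset_extend[OF subset_UNIV ind])
  define \<psi> where "\<psi> f = V.representation B' f x" for f
  show thesis
  proof
    show "\<psi> (f + g) = \<psi> f + \<psi> g" for f g
      unfolding \<psi>_def by (subst V.representation_add[OF B'(3)]) (use B'(4) in auto)
    show "\<psi> x = 1" unfolding \<psi>_def by (subst V.representation_basis[OF B'(3)]) (use B'(1) in auto)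
    show "\<psi> f = 0" if "f \<in> K" for f
    proof -
      have f: "f \<in> V.span B" using that sp by simp
      have "B \<subseteq> B'" using B' by auto
      have "V.representation B' f = V.representation B f"
        by (rule V.representation_extend[OF B'(3) f \<open>B \<subseteq> B'\<close>])
      moreover have "x \<notin> B" using x B by auto
      ultimately show ?thesis unfolding \<psi>_def
        using V.representation_ne_zero[of B f x] by metis
    qed
  qed
qed

lemma plucker_words_functional:
  fixes \<psi> :: "Defs.poly \<Rightarrow> bit"
  assumes add: "\<And>f g. \<psi> (f + g) = \<psi> f + \<psi> g" and K: "\<And>f. f \<in> Kw d \<Longrightarrow> \<psi> f = 0"
  shows "plucker_words d (\<lambda>w. length w = d \<and> set w \<subseteq> edges \<and> \<psi> (monomial (expo w)) = 1)"
    (is "plucker_words d ?Q")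
proof
  have zero: "\<psi> 0 = 0" using add[of 0 0] by simp
  let ?m = "\<lambda>w. monomial (expo w)"
  have two: "?Q (u @ {v,x} # {v,y} # w) = ?Q (u @ {v,y} # {v,x} # w)"
      "?Q (u @ {v,x} # {v,x} # {v,y} # w) = ?Q (u @ {v,y} # {v,y} # {v,x} # w)"
    if d: "distinct [v,x,y]" "v < 5" "x < 5" "y < 5" for u w v x y
  proof -
    have C: "{v,x,y} \<subseteq> {..<5}" "card {v,x,y} = 3" using d by auto
    have D: "{v,x,y} - {v} = {x,y}" "{v,x,y} - {x} = {v,y}" "{v,x,y} - {y} = {v,x}" using d by auto
    have e: "{v,x} \<in> edges" "{v,y} \<in> edges" using d by (auto intro!: edgesI)
    have "\<psi> (?m (u @ {v,x} # {v,y} # w)) = 1 \<longleftrightarrow> \<psi> (?m (u @ {v,y} # {v,x} # w)) = 1"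
      if "set u \<subseteq> edges" "set w \<subseteq> edges" "length u + length w + 2 = d"
      using K[OF relation_two[OF that d(2) C]] d(1) unfolding D by (simp add: D add)
    then show "?Q (u @ {v,x} # {v,y} # w) = ?Q (u @ {v,y} # {v,x} # w)" using e by auto
    have "\<psi> (?m (u @ {v,x} # {v,x} # {v,y} # w)) = 1 \<longleftrightarrow> \<psi> (?m (u @ {v,y} # {v,y} # {v,x} # w)) = 1"
      if "set u \<subseteq> edges" "set w \<subseteq> edges" "length u + length w + 3 = d"
      using K[OF relation_three[OF that d(2) C]] d(1) unfolding D by (simp add: D add)
    then show "?Q (u @ {v,x} # {v,x} # {v,y} # w) = ?Q (u @ {v,y} # {v,y} # {v,x} # w)" using e by auto
  qed
  show "?Q (u @ {v,x} # {v,y} # w) = ?Q (u @ {v,y} # {v,x} # w)"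
    if "distinct [v,x,y]" "v < 5" "x < 5" "y < 5" for u w v x y by (rule two(1)[OF that])
  show "?Q (u @ {v,x} # {v,x} # {v,y} # w) = ?Q (u @ {v,y} # {v,y} # {v,x} # w)"
    if "distinct [v,x,y]" "v < 5" "x < 5" "y < 5" for u w v x y by (rule two(2)[OF that])
  have three: "?Q (u @ {v,x} # {y,z} # w) = (?Q (u @ {v,y} # {x,z} # w) \<noteq> ?Q (u @ {v,z} # {x,y} # w))"
      "?Q (u @ {v,x} # {v,x} # {y,z} # w) = (?Q (u @ {v,y} # {v,y} # {x,z} # w) \<noteq> ?Q (u @ {v,z} # {v,z} # {x,y} # w))"
    if d: "quad v x y z" for u w v x y z
  proof -
    have C: "{x,y,z} \<subseteq> {..<5}" "card {x,y,z} = 3" and v: "v < 5" using d by (auto simp: quad_def)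
    have D: "{x,y,z} - {v} = {x,y,z}" "{x,y,z} - {x} = {y,z}" "{x,y,z} - {y} = {x,z}" "{x,y,z} - {z} = {x,y}"
      using d by (auto simp: quad_def)
    have n: "x \<noteq> y" "x \<noteq> z" "y \<noteq> z" using d by (auto simp: quad_def)
    have e: "{v,x} \<in> edges" "{v,y} \<in> edges" "{v,z} \<in> edges" "{y,z} \<in> edges" "{x,z} \<in> edges" "{x,y} \<in> edges"
      using d by (auto intro!: edgesI simp: quad_def)
    have b: "p = 1 \<longleftrightarrow> (q = 1) \<noteq> (r = 1)" if "p + q + r = 0" for p q r :: bit
      using that by (cases p; cases q; cases r) auto
    have "\<psi> (?m (u @ {v,x} # {y,z} # w)) + \<psi> (?m (u @ {v,y} # {x,z} # w)) + \<psi> (?m (u @ {v,z} # {x,y} # w)) = 0"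
      if "set u \<subseteq> edges" "set w \<subseteq> edges" "length u + length w + 2 = d"
      using K[OF relation_two[OF that v C]] n unfolding D
      by (cases "\<psi> (?m (u @ {v,x} # {y,z} # w))"; cases "\<psi> (?m (u @ {v,y} # {x,z} # w))"; cases "\<psi> (?m (u @ {v,z} # {x,y} # w))") (simp_all add: D add)
    from b[OF this] show "?Q (u @ {v,x} # {y,z} # w) = (?Q (u @ {v,y} # {x,z} # w) \<noteq> ?Q (u @ {v,z} # {x,y} # w))"
      using e by auto
    have "\<psi> (?m (u @ {v,x} # {v,x} # {y,z} # w)) + \<psi> (?m (u @ {v,y} # {v,y} # {x,z} # w)) + \<psi> (?m (u @ {v,z} # {v,z} # {x,y} # w)) = 0"
      if "set u \<subseteq> edges" "set w \<subseteq> edges" "length u + length w + 3 = d"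
      using K[OF relation_three[OF that v C]] n unfolding D
      by (cases "\<psi> (?m (u @ {v,x} # {v,x} # {y,z} # w))"; cases "\<psi> (?m (u @ {v,y} # {v,y} # {x,z} # w))"; cases "\<psi> (?m (u @ {v,z} # {v,z} # {x,y} # w))") (simp_all add: D add)
    from b[OF this] show "?Q (u @ {v,x} # {v,x} # {y,z} # w) = (?Q (u @ {v,y} # {v,y} # {x,z} # w) \<noteq> ?Q (u @ {v,z} # {v,z} # {x,y} # w))"
      using e by auto
  qed
  show "?Q (u @ {v,x} # {y,z} # w) = (?Q (u @ {v,y} # {x,z} # w) \<noteq> ?Q (u @ {v,z} # {x,y} # w))"
    if "quad v x y z" for u w v x y z by (rule three(1)[OF that])
  show "?Q (u @ {v,x} # {v,x} # {y,z} # w) =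
      (?Q (u @ {v,y} # {v,y} # {x,z} # w) \<noteq> ?Q (u @ {v,z} # {v,z} # {x,y} # w))"
    if "quad v x y z" for u w v x y z by (rule three(2)[OF that])
qed auto

lemma words_same_set:
  assumes "5 \<le> d" "set xs \<subseteq> edges" "set xs = set ys" "length xs = d" "length ys = d"
  shows "monomial (expo xs) + monomial (expo ys) \<in> Kw d"
proof (rule ccontr)
  assume n: "monomial (expo xs) + monomial (expo ys) \<notin> Kw d"
  obtain \<psi> where \<psi>: "\<And>f g. \<psi> (f + g) = \<psi> f + \<psi> g" "\<And>f. f \<in> Kw d \<Longrightarrow> \<psi> f = (0::bit)"
    "\<psi> (monomial (expo xs) + monomial (expo ys)) = 1" by (rule ex_functional[OF subspace_Kw n]) blast
  interpret plucker_words d "\<lambda>w. length w = d \<and> set w \<subseteq> edges \<and> \<psi> (monomial (expo w)) = 1"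
    by (rule plucker_words_functional[OF \<psi>(1,2)])
  show False using Q_set[OF assms(1,3)] \<psi>(3) assms by (cases "\<psi> (monomial (expo xs))"; cases "\<psi> (monomial (expo ys))") (auto simp: \<psi>(1))
qed

lemma words_plucker:
  assumes "5 \<le> d" "quad v x y z" "H \<subseteq> edges" "finite H" "card H \<le> d - 2"
    and l: "length xs = d" "length ys = d" "length zs = d"
    and s: "set xs = H \<union> {{v,x},{y,z}}" "set ys = H \<union> {{v,y},{x,z}}" "set zs = H \<union> {{v,z},{x,y}}"
  shows "monomial (expo xs) + monomial (expo ys) + monomial (expo zs) \<in> Kw d"
proof (rule ccontr)
  assume n: "monomial (expo xs) + monomial (expo ys) + monomial (expo zs) \<notin> Kw d"
  obtain \<psi> where \<psi>: "\<And>f g. \<psi> (f + g) = \<psi> f + \<psi> g" "\<And>f. f \<in> Kw d \<Longrightarrow> \<psi> f = (0::bit)"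
    "\<psi> (monomial (expo xs) + monomial (expo ys) + monomial (expo zs)) = 1"
    by (rule ex_functional[OF subspace_Kw n]) blast
  interpret plucker_words d "\<lambda>w. length w = d \<and> set w \<subseteq> edges \<and> \<psi> (monomial (expo w)) = 1"
    by (rule plucker_words_functional[OF \<psi>(1,2)])
  have e: "set xs \<subseteq> edges" "set ys \<subseteq> edges" "set zs \<subseteq> edges"
    unfolding s using assms(2,3) by (auto intro!: edgesI simp: quad_def)
  show False using graph_plucker[OF assms(1,2,4,5) l s] \<psi>(3) e l
    by (cases "\<psi> (monomial (expo xs))"; cases "\<psi> (monomial (expo ys))"; cases "\<psi> (monomial (expo zs))")
      (auto simp: \<psi>(1))
qed

section \<open>Functionals vanishing on hit polynomials\<close>

type_synonym tripoly = "bit Polynomial.poly Polynomial.poly Polynomial.poly"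

definition Mon :: "nat \<times> nat \<times> nat \<Rightarrow> tripoly" where
  "Mon = (\<lambda>(p, q, r). monom (monom (monom 1 r) q) p)"

text \<open>The total Steenrod square of \<^term>\<open>Mon e\<close>, obtained by substituting \<open>y + y\<^sup>2\<close> for each variable \<open>y\<close>.\<close>
definition SqMon :: "nat \<times> nat \<times> nat \<Rightarrow> tripoly" where
  "SqMon = (\<lambda>(p, q, r). [:0, 1, 1:] ^ p * [:[:0, 1, 1:] ^ q * [:[:0, 1, 1:] ^ r:]:])"

definition kap :: "nat \<Rightarrow> tripoly \<Rightarrow> bit" where
  "kap N g = coeff (coeff (coeff g N) N) N"

lemma kap_add: "kap N (f + g) = kap N f + kap N g" by (simp add: kap_def)
lemma kap_0 [simp]: "kap N 0 = 0" by (simp add: kap_def)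
lemma kap_sum: "kap N (sum f A) = (\<Sum>x\<in>A. kap N (f x))"
  by (simp add: kap_def coeff_sum)
lemma kap_sum_list: "kap N (sum_list (map f xs)) = (\<Sum>x\<leftarrow>xs. kap N (f x))"
  by (induction xs) (auto simp: kap_add)
lemma kap_of_nat: "kap N (of_nat n * g) = of_nat n * kap N g"
  by (induction n) (simp_all add: kap_add distrib_right)

lemma tripoly_add_self [simp]: "(f :: tripoly) + f = 0"
  by (intro poly_eqI) (simp only: coeff_add coeff_0, simp)

lemma Mon_mult: "Mon e * Mon f = Mon (fst e + fst f, fst (snd e) + fst (snd f), snd (snd e) + snd (snd f))"
  by (cases e; cases f) (simp add: Mon_def mult_monom)

lemma SqMon_mult: "SqMon e * SqMon f = SqMon (fst e + fst f, fst (snd e) + fst (snd f), snd (snd e) + snd (snd f))"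
  by (cases e; cases f) (simp add: SqMon_def power_add algebra_simps)

lemma kap_Mon: "kap N (Mon (p, q, r)) = (if p = N \<and> q = N \<and> r = N then 1 else 0)"
  by (auto simp: kap_def Mon_def)

lemma coeff_011_power:
  "coeff ([:0, 1, 1:] ^ p :: 'a::comm_ring_1 Polynomial.poly) k = of_nat (if p \<le> k then p choose (k - p) else 0)"
proof -
  have "[:0, 1, 1:] = monom 1 1 * ([:1, 1:] :: 'a Polynomial.poly)" by (simp add: monom_altdef)
  then have "[:0, 1, 1:] ^ p = (monom 1 1 * ([:1, 1:] :: 'a Polynomial.poly)) ^ p" by (rule arg_cong)
  also have "\<dots> = monom 1 p * [:1, 1:] ^ p" unfolding power_mult_distrib monom_power by simp
  finally have "[:0, 1, 1:] ^ p = monom 1 p * ([:1, 1:] ^ p :: 'a Polynomial.poly)" .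
  moreover have "coeff ([:1, 1:] ^ p :: 'a Polynomial.poly) i = of_nat (p choose i)" for i
  proof (cases "i \<le> p")
    case False
    then show ?thesis
      using degree_power_le[of "[:1, 1:] :: 'a Polynomial.poly" p] by (simp add: coeff_eq_0 binomial_eq_0)
  qed (simp add: coeff_linear_poly_power)
  ultimately show ?thesis by (auto simp: coeff_monom_mult)
qed

lemma odd_choose_complement:
  assumes "p \<le> 2 ^ d - 1" "odd (p choose (2 ^ d - 1 - p))"
  shows "p = 2 ^ d - 1"
  using assms
proof (induction d arbitrary: p)
  case (Suc d)
  define M :: nat where "M = 2 ^ d - 1"
  have N: "2 ^ Suc d - 1 = Suc (2 * M)" unfolding M_def by (induction d) auto
  show ?case
  proof (cases "even p")
    case True
    then obtain p' where p: "p = 2 * p'" by blast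
    then have "2 ^ Suc d - 1 - p = Suc (2 * (M - p'))" using Suc.prems(1) unfolding N by simp
    then show ?thesis using Suc.prems(2) choose_double_parity(2) p by metis
  next
    case False
    then obtain p' where p: "p = Suc (2 * p')" by (metis oddE Suc_eq_plus1)
    then have "2 ^ Suc d - 1 - p = 2 * (M - p')" unfolding N by simp
    then have "odd (p' choose (M - p'))" using Suc.prems(2) choose_double_parity(3) p by metis
    then have "p' = M" using Suc.IH[of p'] Suc.prems(1) p N by (simp add: M_def)
    then show ?thesis using p N by simp
  qed
qed simp

lemma kap_SqMon: "kap (2 ^ d - 1) (SqMon e) = kap (2 ^ d - 1) (Mon e)"
proof -
  obtain p q r where e: "e = (p, q, r)" by (cases e)
  let ?N = "2 ^ d - 1 :: nat"
  let ?c = "\<lambda>p. of_nat (if p \<le> ?N then p choose (?N - p) else 0) :: bit"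
  have c: "?c p = (if p = ?N then 1 else 0)" for p
    using odd_choose_complement[of p d] unfolding of_nat_bit by auto
  have pc: "coeff (f * [:g:]) k = coeff f k * g" for f :: "'a::comm_ring_1 Polynomial.poly" and g k
    by (simp add: mult.commute[of f "[:g:]"] mult.commute[of g])
  have on: "coeff (of_nat n * f) k = of_nat n * coeff f k" for f :: "'a::comm_ring_1 Polynomial.poly" and n k
    by (simp add: of_nat_poly)
  have "kap ?N (SqMon e) = ?c p * (?c q * ?c r)"
    unfolding kap_def SqMon_def e prod.case pc coeff_011_power on ..
  also have "\<dots> = kap ?N (Mon e)" unfolding c e kap_Mon by simp
  finally show ?thesis .
qed

text \<open>The polynomial \<open>g\<close> is homogeneous of degree \<open>m\<close> with total square \<open>g'\<close>. As a relation it needs no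
  proof that the total square is well defined.\<close>
definition sq_pair :: "nat \<Rightarrow> tripoly \<Rightarrow> tripoly \<Rightarrow> bool" where
  "sq_pair m g g' \<longleftrightarrow> (\<exists>es. (\<forall>(p, q, r) \<in> set es. p + q + r = m) \<and>
     g = (\<Sum>e\<leftarrow>es. Mon e) \<and> g' = (\<Sum>e\<leftarrow>es. SqMon e))"

lemma sq_pair_Mon: "sq_pair (p + q + r) (Mon (p, q, r)) (SqMon (p, q, r))"
  unfolding sq_pair_def by (intro exI[of _ "[(p, q, r)]"]) simp

lemma sq_pair_0: "sq_pair m 0 0"
  unfolding sq_pair_def by (intro exI[of _ "[]"]) simp

lemma sq_pair_1: "sq_pair 0 1 1"
  using sq_pair_Mon[of 0 0 0] by (simp add: Mon_def SqMon_def monom_0 one_pCons)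

lemma sq_pair_add:
  assumes "sq_pair m f f'" "sq_pair m g g'"
  shows "sq_pair m (f + g) (f' + g')"
proof -
  obtain es fs where "\<forall>(p, q, r) \<in> set es. p + q + r = m" "\<forall>(p, q, r) \<in> set fs. p + q + r = m"
    "f = (\<Sum>e\<leftarrow>es. Mon e)" "f' = (\<Sum>e\<leftarrow>es. SqMon e)" "g = (\<Sum>e\<leftarrow>fs. Mon e)" "g' = (\<Sum>e\<leftarrow>fs. SqMon e)"
    using assms unfolding sq_pair_def by blast
  then show ?thesis unfolding sq_pair_def by (intro exI[of _ "es @ fs"]) auto
qed

lemma sum_list_mult_product:
  fixes f :: "'a \<Rightarrow> 'b::comm_ring_1"
  assumes "\<And>x y. f x * f y = f (h x y)"
  shows "(\<Sum>x\<leftarrow>xs. f x) * (\<Sum>y\<leftarrow>ys. f y) = (\<Sum>z\<leftarrow>concat (map (\<lambda>x. map (h x) ys) xs). f z)"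
proof (induction xs)
  case (Cons x xs)
  have "f x * (\<Sum>y\<leftarrow>ys. f y) = (\<Sum>z\<leftarrow>map (h x) ys. f z)"
    by (induction ys) (simp_all add: distrib_left assms)
  then show ?case using Cons by (simp add: distrib_right)
qed simp

lemma sq_pair_mult:
  assumes "sq_pair m f f'" "sq_pair n g g'"
  shows "sq_pair (m + n) (f * g) (f' * g')"
proof -
  obtain es fs where *: "\<forall>(p, q, r) \<in> set es. p + q + r = m" "\<forall>(p, q, r) \<in> set fs. p + q + r = n"
    "f = (\<Sum>e\<leftarrow>es. Mon e)" "f' = (\<Sum>e\<leftarrow>es. SqMon e)" "g = (\<Sum>e\<leftarrow>fs. Mon e)" "g' = (\<Sum>e\<leftarrow>fs. SqMon e)"
    using assms unfolding sq_pair_def by blast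
  define h :: "nat \<times> nat \<times> nat \<Rightarrow> nat \<times> nat \<times> nat \<Rightarrow> nat \<times> nat \<times> nat" where
    "h e f = (fst e + fst f, fst (snd e) + fst (snd f), snd (snd e) + snd (snd f))" for e f
  have "\<forall>(p, q, r) \<in> set (concat (map (\<lambda>x. map (h x) fs) es)). p + q + r = m + n"
    using *(1,2) by (fastforce simp: h_def)
  moreover have "f * g = (\<Sum>e\<leftarrow>concat (map (\<lambda>x. map (h x) fs) es). Mon e)"
    "f' * g' = (\<Sum>e\<leftarrow>concat (map (\<lambda>x. map (h x) fs) es). SqMon e)"
    unfolding * by (intro sum_list_mult_product; simp add: Mon_mult SqMon_mult h_def)+
  ultimately show ?thesis unfolding sq_pair_def by blast
qed

lemma sq_pair_power: "sq_pair m f f' \<Longrightarrow> sq_pair (m * n) (f ^ n) (f' ^ n)"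
  by (induction n) (auto simp: sq_pair_1 dest: sq_pair_mult)

lemma sq_pair_prod:
  assumes "finite A" "\<And>j. j \<in> A \<Longrightarrow> sq_pair (m j) (f j) (f' j)"
  shows "sq_pair (\<Sum>j\<in>A. m j) (\<Prod>j\<in>A. f j) (\<Prod>j\<in>A. f' j)"
  using assms by (induction A rule: finite_induct) (auto simp: sq_pair_1 intro!: sq_pair_mult)

lemma sq_pair_kap:
  assumes "sq_pair m g g'"
  shows "kap (2 ^ d - 1) g' = kap (2 ^ d - 1) g" "m \<noteq> 3 * N \<Longrightarrow> kap N g = 0"
proof -
  obtain es where *: "\<forall>(p, q, r) \<in> set es. p + q + r = m"
    "g = (\<Sum>e\<leftarrow>es. Mon e)" "g' = (\<Sum>e\<leftarrow>es. SqMon e)"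
    using assms unfolding sq_pair_def by blast
  show "kap (2 ^ d - 1) g' = kap (2 ^ d - 1) g" unfolding * kap_sum_list kap_SqMon ..
  assume m: "m \<noteq> 3 * N"
  have "\<forall>e\<in>set es. kap N (Mon e) = 0" using *(1) m by (auto simp: kap_Mon)
  then have "(\<Sum>e\<leftarrow>es. kap N (Mon e)) = 0" by (induction es) auto
  then show "kap N g = 0" unfolding * kap_sum_list .
qed

definition Y :: "nat \<Rightarrow> tripoly" where
  "Y i = Mon (if i = 0 then 1 else 0, if i = 1 then 1 else 0, if i = 2 then 1 else 0)"

definition lin :: "(nat \<Rightarrow> bool) \<Rightarrow> tripoly" where
  "lin c = (\<Sum>i<3. if c i then Y i else 0)"

lemma sq_pair_lin: "sq_pair 1 (lin c) (lin c + (lin c)\<^sup>2)"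
proof -
  have Y: "sq_pair 1 (Y i) (Y i + (Y i)\<^sup>2)" if "i < 3" for i
  proof -
    have "i = 0 \<or> i = 1 \<or> i = 2" using that by auto
    then show ?thesis
      using sq_pair_Mon[of 1 0 0] sq_pair_Mon[of 0 1 0] sq_pair_Mon[of 0 0 1]
      by (auto simp: Y_def Mon_def SqMon_def monom_altdef power2_eq_square one_pCons)
  qed
  have sq: "(x + y)\<^sup>2 = x\<^sup>2 + y\<^sup>2" for x y :: tripoly
    unfolding power2_eq_square distrib_left distrib_right
    by (metis (no_types, lifting) add.assoc add.commute add_0 mult.commute tripoly_add_self)
  have "sq_pair 1 (\<Sum>i<n. if c i then Y i else 0)
      ((\<Sum>i<n. if c i then Y i else 0) + (\<Sum>i<n. if c i then Y i else 0)\<^sup>2)" if "n \<le> 3" for n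
    using that
  proof (induction n)
    case (Suc n)
    have "sq_pair 1 (if c n then Y n else 0) ((if c n then Y n else 0) + (if c n then Y n else 0)\<^sup>2)"
      using Y[of n] Suc.prems by (auto simp: sq_pair_0)
    from sq_pair_add[OF Suc.IH this] Suc.prems show ?case by (simp add: sq algebra_simps)
  qed (simp add: sq_pair_0)
  from this[of 3] show ?thesis by (simp add: lin_def)
qed

definition sub :: "(nat \<Rightarrow> nat \<Rightarrow> bool) \<Rightarrow> expv \<Rightarrow> tripoly" where
  "sub L a = (\<Prod>j<5. lin (L j) ^ a j)"

lemma sq_pair_sub: "sq_pair (mdeg a) (sub L a) (\<Prod>j<5. (lin (L j) + (lin (L j))\<^sup>2) ^ a j)"
  using sq_pair_prod[of "{..<5}" a "\<lambda>j. lin (L j) ^ a j" "\<lambda>j. (lin (L j) + (lin (L j))\<^sup>2) ^ a j"]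
    sq_pair_power[OF sq_pair_lin] by (simp add: sub_def mdeg_def)

definition phi :: "(nat \<Rightarrow> nat \<Rightarrow> bool) \<Rightarrow> nat \<Rightarrow> Defs.poly \<Rightarrow> bit" where
  "phi L d f = (\<Sum>a | mono5 a \<and> mdeg a = deg_three_d d. f a * kap (2 ^ d - 1) (sub L a))"

lemma phi_add: "phi L d (f + g) = phi L d f + phi L d g"
  unfolding phi_def plus_fun_def distrib_right sum.distrib ..

lemma phi_scl: "phi L d (scl c f) = c * phi L d f"
  unfolding phi_def scl_def sum_distrib_left mult.assoc ..

lemma phi_monomial:
  assumes "mono5 a" "mdeg a = deg_three_d d"
  shows "phi L d (monomial a) = kap (2 ^ d - 1) (sub L a)"
proof -
  have "phi L d (monomial a) = (\<Sum>b | mono5 b \<and> mdeg b = deg_three_d d. if b = a then kap (2 ^ d - 1) (sub L b) else 0)"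
    unfolding phi_def monomial_def by (intro sum.cong) auto
  then show ?thesis using assms finite_degree by (simp add: sum.delta)
qed

lemma kap_sub_degree:
  assumes "mdeg a \<noteq> deg_three_d d"
  shows "kap (2 ^ d - 1) (sub L a) = 0"
  using sq_pair_kap(2)[OF sq_pair_sub] assms by (simp add: deg_three_d)

lemma total_square_expand:
  assumes "mono5 a"
  defines "B \<equiv> (\<lambda>g j. if j < 5 then a j + g j else 0) ` (\<Pi>\<^sub>E j\<in>{..<5}. {..a j})"
  shows "(\<Prod>j<5. (lin (L j) + (lin (L j))\<^sup>2) ^ a j) = (\<Sum>b\<in>B. of_nat (\<Prod>j<5. a j choose (b j - a j)) * sub L b)"
proof -
  let ?l = "\<lambda>j. lin (L j)" and ?F = "\<Pi>\<^sub>E j\<in>{..<5}. {..a j}" and ?h = "\<lambda>g j. if j < 5 then a j + g j else 0"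
  have pw: "(x + x\<^sup>2) ^ n = (\<Sum>i\<le>n. of_nat (n choose i) * x ^ (n + i))" for x :: tripoly and n
  proof -
    have "(x\<^sup>2 + x) ^ n = (\<Sum>i\<le>n. of_nat (n choose i) * (x\<^sup>2) ^ i * x ^ (n - i))" by (rule binomial_ring)
    also have "\<dots> = (\<Sum>i\<le>n. of_nat (n choose i) * x ^ (n + i))"
    proof (intro sum.cong refl)
      fix i assume "i \<in> {..n}"
      then have "n + i = 2 * i + (n - i)" by simp
      then show "of_nat (n choose i) * (x\<^sup>2) ^ i * x ^ (n - i) = of_nat (n choose i) * x ^ (n + i)"
        by (simp only: power_mult[symmetric] mult.assoc power_add[symmetric])
    qed
    finally show ?thesis by (simp add: add.commute)
  qed
  have inj: "inj_on ?h ?F"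
  proof (rule inj_onI)
    fix g g' assume g: "g \<in> ?F" "g' \<in> ?F" "?h g = ?h g'"
    show "g = g'"
    proof (rule PiE_ext[OF g(1,2)])
      show "g j = g' j" if "j \<in> {..<5}" for j using fun_cong[OF g(3), of j] that by simp
    qed
  qed
  have "(\<Prod>j<5. (?l j + (?l j)\<^sup>2) ^ a j) = (\<Prod>j<5. \<Sum>i\<le>a j. of_nat (a j choose i) * ?l j ^ (a j + i))"
    by (simp add: pw)
  also have "\<dots> = (\<Sum>g\<in>?F. \<Prod>j<5. of_nat (a j choose g j) * ?l j ^ (a j + g j))"
    by (rule prod_sum_PiE) auto
  also have "\<dots> = (\<Sum>g\<in>?F. of_nat (\<Prod>j<5. a j choose (?h g j - a j)) * sub L (?h g))"
    by (intro sum.cong refl) (simp add: prod.distrib sub_def of_nat_prod)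
  also have "\<dots> = (\<Sum>b\<in>B. of_nat (\<Prod>j<5. a j choose (b j - a j)) * sub L b)"
    unfolding B_def by (subst sum.reindex[OF inj]) simp
  finally show ?thesis .
qed

lemma phi_Sq:
  assumes "0 < k" "mono5 a"
  shows "phi L d (Sq k a) = 0"
proof (cases "mdeg a + k = deg_three_d d")
  case False
  have "Sq k a b = 0" if "mdeg b = deg_three_d d" for b
  proof (rule ccontr)
    assume "Sq k a b \<noteq> 0"
    then have *: "\<forall>j. a j \<le> b j" "(\<Sum>j<5. b j - a j) = k" by (auto simp: Sq_def split: if_splits)
    have "mdeg b = mdeg a + k"
      unfolding mdeg_def *(2)[symmetric] sum.distrib[symmetric] using *(1) by (intro sum.cong) auto
    then show False using False that by simp
  qed
  then show ?thesis unfolding phi_def by (intro sum.neutral) auto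
next
  case True
  let ?N = "2 ^ d - 1 :: nat" and ?M = "{b. mono5 b \<and> mdeg b = deg_three_d d}"
  define B where "B = (\<lambda>g j. if j < 5 then a j + g j else 0) ` (\<Pi>\<^sub>E j\<in>{..<5}. {..a j})"
  let ?c = "\<lambda>b. of_nat (\<Prod>j<5. a j choose (b j - a j)) * kap ?N (sub L b)"
  have fin: "finite B" unfolding B_def by (intro finite_imageI finite_PiE) auto
  have memB: "b \<in> B \<longleftrightarrow> mono5 b \<and> (\<forall>j<5. a j \<le> b j \<and> b j - a j \<le> a j)" for b
  proof
    assume "b \<in> B"
    then obtain g where g: "g \<in> (\<Pi>\<^sub>E j\<in>{..<5}. {..a j})" "b = (\<lambda>j. if j < 5 then a j + g j else 0)"
      unfolding B_def by blast
    have "g j \<le> a j" if "j < 5" for j using PiE_mem[OF g(1), of j] that by simp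
    then show "mono5 b \<and> (\<forall>j<5. a j \<le> b j \<and> b j - a j \<le> a j)" by (simp add: g(2) mono5_def)
  next
    assume b: "mono5 b \<and> (\<forall>j<5. a j \<le> b j \<and> b j - a j \<le> a j)"
    show "b \<in> B" unfolding B_def
    proof (rule image_eqI)
      show "b = (\<lambda>j. if j < 5 then a j + (\<lambda>j\<in>{..<5}. b j - a j) j else 0)"
        using b by (auto simp: fun_eq_iff mono5_def not_less)
      show "(\<lambda>j\<in>{..<5}. b j - a j) \<in> (\<Pi>\<^sub>E j\<in>{..<5}. {..a j})"
        using b by (intro restrict_PiE_iff[THEN iffD2]) simp
    qed
  qed
  have "phi L d (Sq k a) = (\<Sum>b\<in>?M \<inter> B. Sq k a b * kap ?N (sub L b))"
    unfolding phi_def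
  proof (rule sum.mono_neutral_right)
    show "\<forall>b\<in>?M - ?M \<inter> B. Sq k a b * kap ?N (sub L b) = 0"
    proof
      fix b assume "b \<in> ?M - ?M \<inter> B"
      then have "mono5 b" "b \<notin> B" by auto
      then obtain j where "j < 5" "\<not> a j \<le> b j \<or> \<not> b j - a j \<le> a j" using memB by blast
      then have "\<not> a j \<le> b j \<or> (\<Prod>j<5. a j choose (b j - a j)) = 0"
        by (auto intro!: prod_zero bexI[of _ j] simp: binomial_eq_0)
      then have "Sq k a b = 0" 
      proof
        assume "(\<Prod>j<5. a j choose (b j - a j)) = 0"
        then show ?thesis unfolding Sq_def by (simp only: of_nat_0 if_cancel)
      qed (auto simp: Sq_def)
      then show "Sq k a b * kap ?N (sub L b) = 0" by simp
    qed
  qed (auto simp: finite_degree)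
  also have "\<dots> = (\<Sum>b\<in>?M \<inter> B. ?c b)"
  proof (intro sum.cong refl)
    fix b assume b: "b \<in> ?M \<inter> B"
    then have b': "\<forall>j<5. a j \<le> b j" "mono5 b" using memB by auto
    then have le: "\<forall>j. a j \<le> b j" "\<forall>j\<ge>5. b j = a j" using assms(2) by (auto simp: mono5_def) (metis le0 not_less)
    have "mdeg b = mdeg a + (\<Sum>j<5. b j - a j)"
      unfolding mdeg_def sum.distrib[symmetric] using le by (intro sum.cong) auto
    then have "(\<Sum>j<5. b j - a j) = k" using b True by simp
    then show "Sq k a b * kap ?N (sub L b) = ?c b" using le by (simp add: Sq_def)
  qed
  also have "\<dots> = (\<Sum>b\<in>B. ?c b)"
    by (rule sum.mono_neutral_left) (use fin memB kap_sub_degree in auto)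
  also have "\<dots> = kap ?N (\<Prod>j<5. (lin (L j) + (lin (L j))\<^sup>2) ^ a j)"
    unfolding total_square_expand[OF assms(2), of L] B_def[symmetric] by (simp only: kap_sum kap_of_nat)
  also have "\<dots> = kap ?N (sub L a)" by (rule sq_pair_kap(1)[OF sq_pair_sub])
  also have "\<dots> = 0" by (rule kap_sub_degree) (use True assms in simp)
  finally show ?thesis .
qed

lemma coeff_square:
  fixes h :: "'a::comm_ring_1 Polynomial.poly"
  assumes "(1::'a) + 1 = 0"
  shows "coeff (h\<^sup>2) n = (if even n then (coeff h (n div 2))\<^sup>2 else 0)"
proof (induction h arbitrary: n)
  case (pCons c h)
  have "x + x = 0" for x :: 'a using assms by (metis distrib_left mult.right_neutral mult_zero_right)
  then have two: "f + f = 0" for f :: "'a Polynomial.poly" by (intro poly_eqI) (simp only: coeff_add coeff_0)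
  have "(pCons c h)\<^sup>2 = pCons (c\<^sup>2) (pCons 0 (h\<^sup>2)) + (pCons 0 (smult c h) + pCons 0 (smult c h))"
    by (simp add: power2_eq_square)
  then have "(pCons c h)\<^sup>2 = pCons (c\<^sup>2) (pCons 0 (h\<^sup>2))" by (simp only: two add_0_right)
  then show ?case
    using pCons.IH by (auto simp: coeff_pCons split: nat.splits)
qed simp

lemma kap_Mon_square:
  assumes "p + q + r \<le> 3"
  shows "kap (2 * N + 1) (Mon (p, q, r) * h\<^sup>2) = kap 1 (Mon (p, q, r)) * kap N h"
proof -
  have c1: "(1 :: bit Polynomial.poly) + 1 = 0" "(1 :: bit Polynomial.poly Polynomial.poly) + 1 = 0"
    by (intro poly_eqI, simp only: coeff_add coeff_0, simp)+
  note sq = coeff_square[OF c1(2)] coeff_square[OF c1(1)] coeff_square[where 'a = bit]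
  consider "p = 1 \<and> q = 1 \<and> r = 1" | "even p" | "even q" | "even r"
    using assms by (cases p; cases q; cases r) auto
  then show ?thesis
  proof cases
    case 1
    then show ?thesis unfolding kap_def Mon_def by (simp add: coeff_monom_mult sq)
  next
    case 2
    then show ?thesis unfolding kap_Mon unfolding kap_def Mon_def by (auto simp: coeff_monom_mult sq)
  next
    case 3
    then show ?thesis unfolding kap_Mon unfolding kap_def Mon_def by (auto simp: coeff_monom_mult sq)
  next
    case 4
    then show ?thesis unfolding kap_Mon unfolding kap_def Mon_def by (auto simp: coeff_monom_mult sq)
  qed
qed

lemma sq_pair_kap_square:
  assumes "sq_pair m g g'" "m \<le> 3"
  shows "kap (2 * N + 1) (g * h\<^sup>2) = kap 1 g * kap N h"
proof -
  obtain es where *: "\<forall>(p, q, r) \<in> set es. p + q + r = m" "g = (\<Sum>e\<leftarrow>es. Mon e)"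
    using assms unfolding sq_pair_def by blast
  show ?thesis using *(1) unfolding *(2)
  proof (induction es)
    case (Cons e es)
    then show ?case using kap_Mon_square[of "fst e" "fst (snd e)" "snd (snd e)" N h] assms(2)
      by (auto simp: distrib_right kap_add)
  qed simp
qed

definition lindet :: "(nat \<Rightarrow> nat \<Rightarrow> bool) \<Rightarrow> nat set \<Rightarrow> bit" where
  "lindet L A = kap 1 (\<Prod>j\<in>A. lin (L j))"

lemma sq_pair_prod_lin:
  assumes "finite A"
  shows "sq_pair (card A) (\<Prod>j\<in>A. lin (L j)) (\<Prod>j\<in>A. lin (L j) + (lin (L j))\<^sup>2)"
  using sq_pair_prod[OF assms, of "\<lambda>_. 1" "\<lambda>j. lin (L j)"] sq_pair_lin by simp

lemma sub_halve: "sub L a = (\<Prod>j | j < 5 \<and> odd (a j). lin (L j)) * (sub L (\<lambda>j. a j div 2))\<^sup>2"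
proof -
  have "sub L a = (\<Prod>j<5. (if odd (a j) then lin (L j) else 1) * (lin (L j) ^ (a j div 2))\<^sup>2)"
    unfolding sub_def
  proof (intro prod.cong refl)
    fix j
    have "a j = a j mod 2 + a j div 2 * 2" by simp
    then have "lin (L j) ^ a j = lin (L j) ^ (a j mod 2) * (lin (L j) ^ (a j div 2))\<^sup>2"
      by (metis power_add power_mult)
    then show "lin (L j) ^ a j = (if odd (a j) then lin (L j) else 1) * (lin (L j) ^ (a j div 2))\<^sup>2"
      by (cases "odd (a j)") (auto simp: odd_iff_mod_2_eq_one)
  qed
  also have "\<dots> = (\<Prod>j<5. if odd (a j) then lin (L j) else 1) * (sub L (\<lambda>j. a j div 2))\<^sup>2"
    by (simp add: prod.distrib sub_def prod_power_distrib)
  also have "(\<Prod>j<5. if odd (a j) then lin (L j) else 1) = (\<Prod>j | j < 5 \<and> odd (a j). lin (L j))"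
    by (subst prod.inter_filter[symmetric]) (auto simp: lessThan_def)
  finally show ?thesis .
qed

lemma kap_sub_Suc:
  assumes "weight a 0 \<le> 3"
  shows "kap (2 ^ Suc d - 1) (sub L a) = lindet L {j. j < 5 \<and> odd (a j)} * kap (2 ^ d - 1) (sub L (\<lambda>j. a j div 2))"
proof -
  have N: "2 ^ Suc d - 1 = 2 * (2 ^ d - 1 :: nat) + 1" by (induction d) auto
  show ?thesis unfolding N lindet_def sub_halve[of L a]
    by (rule sq_pair_kap_square[OF sq_pair_prod_lin]) (use assms in \<open>auto simp: weight_0\<close>)
qed

lemma kap_sub_wless:
  assumes "wless (weight a) (three_d d)"
  shows "kap (2 ^ d - 1) (sub L a) = 0"
  using assms
proof (induction d arbitrary: a)
  case 0
  then show ?case by (auto simp: wless_def three_d_def)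
next
  case (Suc d)
  then obtain i where i: "\<forall>j<i. weight a j = three_d (Suc d) j" "weight a i < three_d (Suc d) i"
    by (auto simp: wless_def)
  show ?case
  proof (cases i)
    case 0
    then have "weight a 0 < 3" using i by (simp add: three_d_def)
    moreover have "lindet L {j. j < 5 \<and> odd (a j)} = 0" unfolding lindet_def
      by (rule sq_pair_kap(2)[OF sq_pair_prod_lin]) (use calculation in \<open>auto simp: weight_0\<close>)
    ultimately show ?thesis by (subst kap_sub_Suc) simp_all
  next
    case (Suc i')
    then have "weight a 0 = 3" using i by (simp add: three_d_def)
    moreover have "wless (weight (\<lambda>j. a j div 2)) (three_d d)" unfolding wless_def
    proof (intro exI[of _ i'] conjI allI impI)
      show "weight (\<lambda>j. a j div 2) j = three_d d j" if "j < i'" for j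
        using i(1)[rule_format, of "Suc j"] that Suc by (simp add: weight_Suc three_d_def)
      show "weight (\<lambda>j. a j div 2) i' < three_d d i'"
        using i(2) Suc by (simp add: weight_Suc three_d_def)
    qed
    ultimately show ?thesis using Suc.IH by (subst kap_sub_Suc) simp_all
  qed
qed

lemma kap_sub_expo:
  assumes "set w \<subseteq> edges"
  shows "kap (2 ^ length w - 1) (sub L (expo w)) = (\<Prod>e\<leftarrow>w. lindet L ({..<5} - e))"
  using assms
proof (induction w)
  case Nil
  have "Mon (0, 0, 0) = 1" by (simp add: Mon_def monom_0 one_pCons)
  then show ?case using kap_Mon[of 0 0 0 0] by (simp add: sub_def)
next
  case (Cons e w)
  have "{j. j < 5 \<and> odd (level e (expo w) j)} = {..<5} - e" by (auto simp: odd_level)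
  then show ?case using Cons kap_sub_Suc[of "level e (expo w)" "length w" L]
    by (simp add: level_div_2 del: power_Suc)
qed

lemma phi_Kw:
  assumes "f \<in> Kw d"
  shows "phi L d f = 0"
proof -
  have sub: "V.subspace {f. phi L d f = 0}"
    by (rule V.subspaceI) (simp_all add: phi_add phi_scl, simp add: phi_def)
  have "span2 (AplusP5 \<union> Pw_minus d) \<subseteq> {f. phi L d f = 0}"
  proof (rule V.span_minimal[OF _ sub], rule Un_least)
    show "AplusP5 \<subseteq> {f. phi L d f = 0}" unfolding AplusP5_def
      by (rule V.span_minimal[OF _ sub]) (auto simp: phi_Sq)
    show "Pw_minus d \<subseteq> {f. phi L d f = 0}" unfolding Pw_minus_def
      by (rule V.span_minimal[OF _ sub]) (auto simp: phi_monomial kap_sub_wless simp del: One_nat_def)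
  qed
  then show ?thesis using assms by (auto simp: Kw_def)
qed

lemma phi_word:
  assumes "set w \<subseteq> edges" "length w = d"
  shows "phi L d (monomial (expo w)) = (\<Prod>e\<leftarrow>w. lindet L ({..<5} - e))"
proof -
  have "mdeg (expo w) = deg_three_d d"
    using mdeg_levels[OF assms(1), of "\<lambda>_. 0"] assms(2) by (simp add: deg_three_d mdeg_def)
  then show ?thesis using kap_sub_expo[OF assms(1), of L] assms(2) by (simp add: phi_monomial)
qed

lemma lindet_three:
  assumes "distinct [p, q, r]"
  shows "lindet L {p, q, r} =
    of_bool (L p 0 \<and> L q 1 \<and> L r 2) + of_bool (L p 0 \<and> L q 2 \<and> L r 1) +
    of_bool (L p 1 \<and> L q 0 \<and> L r 2) + of_bool (L p 1 \<and> L q 2 \<and> L r 0) +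
    of_bool (L p 2 \<and> L q 0 \<and> L r 1) + of_bool (L p 2 \<and> L q 1 \<and> L r 0)"
proof -
  have i: "(if a then x else 0) * y = (if a then x * y else 0)" for a and x y :: tripoly by simp
  have k: "kap 1 (if a then x else 0) = of_bool a * kap 1 x" for a x by simp
  have "lindet L {p,q,r} = kap 1 (lin (L p) * (lin (L q) * lin (L r)))"
    using assms by (simp add: lindet_def)
  also have "lin (L p) * (lin (L q) * lin (L r)) = (\<Sum>i<3. \<Sum>j<3. \<Sum>k<3.
      (if L p i then Y i else 0) * ((if L q j then Y j else 0) * (if L r k then Y k else 0)))"
    unfolding lin_def by (simp only: sum_product) (simp only: sum_distrib_left)
  also have "\<dots> = (\<Sum>i<3. \<Sum>j<3. \<Sum>k<3. if L p i \<and> L q j \<and> L r k then Y i * Y j * Y k else 0)"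
    by (intro sum.cong refl) (simp add: mult.assoc)
  also have "kap 1 \<dots> = (\<Sum>i<3. \<Sum>j<3. \<Sum>k<3. of_bool (L p i \<and> L q j \<and> L r k) * kap 1 (Y i * Y j * Y k))"
    by (simp only: kap_sum k)
  finally have eq: "lindet L {p,q,r} =
    (\<Sum>i<3. \<Sum>j<3. \<Sum>k<3. of_bool (L p i \<and> L q j \<and> L r k) * kap 1 (Y i * Y j * Y k))" .
  have s: "(\<Sum>i<3. f i) = f 0 + f 1 + f 2" for f :: "nat \<Rightarrow> bit"
    by (simp add: numeral_3_eq_3 numeral_2_eq_2 add.assoc)
  have z: "kap 1 (Y i * Y i * Y k) = 0" "kap 1 (Y i * Y k * Y i) = 0" "kap 1 (Y k * Y i * Y i) = 0" for i k
    by (auto simp: Y_def Mon_mult kap_Mon)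
  have o: "kap 1 (Y 0 * Y 1 * Y 2) = 1" "kap 1 (Y 0 * Y 2 * Y 1) = 1" "kap 1 (Y 1 * Y 0 * Y 2) = 1"
    "kap 1 (Y 1 * Y 2 * Y 0) = 1" "kap 1 (Y 2 * Y 0 * Y 1) = 1" "kap 1 (Y 2 * Y 1 * Y 0) = 1"
    by (auto simp: Y_def Mon_mult kap_Mon)
  show ?thesis unfolding eq s by (simp only: z o mult_zero_right mult_1_right add_0_left add_0_right add.assoc)
qed

section \<open>The elimination tables\<close>

text \<open>A graph is coded by the list of membership bits of its edges in the order \<open>ends\<close>, and this list by an
  integer with the bit of \<open>(0,1)\<close> least significant. Conditionals replace conjunctions in the functions
  below because symbolic evaluation does not evaluate \<open>\<and>\<close> lazily.\<close>

fun bits :: "nat \<Rightarrow> int \<Rightarrow> bool list" where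
  "bits 0 c = []"
| "bits (Suc n) c = odd c # bits n (c div 2)"

definition ends :: "(nat \<times> nat) list" where
  "ends = [(0,1), (0,2), (0,3), (0,4), (1,2), (1,3), (1,4), (2,3), (2,4), (3,4)]"

definition quads :: "(nat \<times> nat \<times> nat \<times> nat) list" where
  "quads = [(1,2,3,4), (1,3,4,2), (1,4,2,3), (0,2,3,4), (0,3,4,2), (0,4,2,3), (0,1,3,4), (0,3,4,1), (0,4,1,3), (0,1,2,4), (0,2,4,1), (0,4,1,2), (0,1,2,3), (0,2,3,1), (0,3,1,2)]"

definition pair_mask :: "nat \<Rightarrow> nat \<Rightarrow> nat \<Rightarrow> nat \<Rightarrow> bool list" where
  "pair_mask v x y z = map (\<lambda>(i, j). (i, j) = (v, x) \<or> (i, j) = (x, v) \<or> (i, j) = (y, z) \<or> (i, j) = (z, y)) ends"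

definition quad_masks :: "nat \<times> nat \<times> nat \<times> nat \<Rightarrow> bool list \<times> bool list \<times> bool list" where
  "quad_masks = (\<lambda>(v, x, y, z). (pair_mask v x y z, pair_mask v y x z, pair_mask v z x y))"

fun orl :: "bool list \<Rightarrow> bool list \<Rightarrow> bool list" where
  "orl (a # as) (b # bs) = (if a then True else b) # orl as bs"
| "orl _ _ = []"

fun count_true :: "bool list \<Rightarrow> nat" where
  "count_true [] = 0"
| "count_true (b # bs) = (if b then Suc (count_true bs) else count_true bs)"

datatype btree = Tip | Br btree btree

fun tmem :: "bool list \<Rightarrow> btree \<Rightarrow> bool" where
  "tmem _ Tip = False"
| "tmem [] (Br l r) = True"
| "tmem (b # bs) (Br l r) = (if b then tmem bs r else tmem bs l)"

fun tins :: "bool list \<Rightarrow> btree \<Rightarrow> btree" where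
  "tins [] t = Br Tip Tip"
| "tins (b # bs) Tip = (if b then Br Tip (tins bs Tip) else Br (tins bs Tip) Tip)"
| "tins (b # bs) (Br l r) = (if b then Br l (tins bs r) else Br (tins bs l) r)"

text \<open>If the graphs \<open>h + m2\<close> and \<open>h + m3\<close> are known to be reducible, or equal, then so is \<open>h + m1\<close>. The
  relation needs \<open>h\<close> to have at most \<open>d - 2\<close> edges; the bound tested here implies this for all
  \<open>d \<ge> 5\<close> for which \<open>h + m1\<close> fits into a word of length \<open>d\<close>.\<close>
fun apply_rule :: "bool list \<Rightarrow> bool list \<times> bool list \<times> bool list \<Rightarrow> btree \<Rightarrow> btree" where
  "apply_rule h (m1, m2, m3) t =
    (if count_true h + 2 \<le> max 5 (count_true (orl h m1)) \<and>
        (if orl h m2 = orl h m3 then True else if tmem (orl h m2) t then tmem (orl h m3) t else False)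
     then tins (orl h m1) t else t)"

fun run_rules :: "(bool list \<times> bool list \<times> bool list) list \<Rightarrow> (int \<times> nat) list \<Rightarrow> btree \<Rightarrow> btree" where
  "run_rules ms [] t = t"
| "run_rules ms ((c, k) # rs) t = run_rules ms rs (apply_rule (bits 10 c) (ms ! k) t)"

fun is_star_at :: "nat \<Rightarrow> bool list \<Rightarrow> (nat \<times> nat) list \<Rightarrow> bool" where
  "is_star_at v (b # bs) ((i, j) # es) = (if b then (if i = v \<or> j = v then is_star_at v bs es else False) else is_star_at v bs es)"
| "is_star_at v _ _ = True"

definition is_star :: "bool list \<Rightarrow> bool" where
  "is_star g = list_ex (\<lambda>v. is_star_at v g ends) [0, 1, 2, 3, 4]"

fun all_bits :: "nat \<Rightarrow> bool list list" where
  "all_bits 0 = [[]]"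
| "all_bits (Suc n) = map (Cons False) (all_bits n) @ map (Cons True) (all_bits n)"

text \<open>The entry \<open>(c, k)\<close> is the relation for the graph \<open>H\<close> with code \<open>c\<close> and the quadruple \<open>quads ! k\<close>.\<close>
definition rules :: "(int \<times> nat) list" where
  "rules = [
    (480,0), (481,0), (482,0), (483,0), (484,0), (485,0), (486,0), (487,0), (488,0), (489,0),
    (490,0), (491,0), (492,0), (493,0), (494,0), (495,0), (396,3), (397,3), (412,3), (413,3),
    (428,3), (429,3), (444,3), (445,3), (460,3), (461,3), (476,3), (477,3), (492,3), (493,3),
    (108,6), (110,6), (124,6), (126,6), (236,6), (238,6), (252,6), (254,6), (364,6), (366,6),
    (380,6), (382,6), (492,6), (90,9), (94,9), (122,9), (126,9), (218,9), (222,9), (250,9),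
    (254,9), (602,9), (606,9), (634,9), (730,9), (54,12), (62,12), (118,12), (126,12), (310,12),
    (318,12), (374,12), (566,12), (574,12), (630,12), (822,12), (0,1), (0,7), (0,11), (0,5),
    (0,12), (16,12), (8,10), (16,10), (1,10), (9,10), (17,10), (1,13), (17,13), (64,11), (65,11),
    (73,9), (81,9), (2,9), (10,9), (18,9), (19,11), (2,12), (18,12), (19,14), (2,5), (256,10),
    (264,10), (272,10), (274,11), (336,11), (256,2), (16,2), (272,2), (128,0), (384,0), (400,1),
    (64,1), (80,1), (336,0), (22,13), (131,13), (35,14), (129,14), (145,13), (4,12), (6,12),
    (38,12), (7,13), (4,3), (6,5), (32,14), (33,14), (161,14), (37,12), (49,12), (132,4), (134,4),
    (130,3), (25,9), (67,9), (66,11), (259,11), (321,11), (322,11), (74,9), (82,9), (512,1),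
    (576,1), (640,1), (896,2), (194,5), (448,1), (784,1), (304,2), (528,2), (800,2), (592,1),
    (656,1), (528,10), (578,1), (66,4), (512,9), (128,13), (132,13), (144,13), (148,13), (146,14),
    (176,14), (32,0), (96,0), (160,0), (224,0), (176,2), (672,2), (8,1), (64,4), (192,4), (256,3),
    (384,3), (386,5), (512,5), (516,5), (768,5), (896,4), (257,2), (260,0), (66,2), (288,11),
    (320,14), (80,5), (200,9), (2,0), (514,1), (528,5), (136,1), (152,1), (640,9), (8,4), (10,4),
    (520,4), (524,3), (776,3), (64,6), (136,4), (138,4), (514,4), (522,4), (642,4), (648,4),
    (518,5), (770,5), (32,7), (96,6), (194,11), (449,11), (322,14), (202,9), (16,4), (128,9),
    (136,9), (152,9), (1,8), (65,8), (97,7), (74,3), (72,4), (520,9), (320,5), (322,5), (768,11),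
    (280,2), (776,10), (784,10), (322,2), (338,5), (258,0), (384,11), (770,2), (784,5), (4,8),
    (5,8), (37,6), (257,3), (260,11), (24,3), (280,3), (268,9), (276,9), (264,13), (280,13),
    (274,6), (290,9), (266,6), (536,4), (512,7), (544,7), (548,8), (608,8), (8,6), (12,6), (72,6),
    (73,7), (584,7), (32,11), (34,11), (1,5), (9,3), (4,10), (12,10), (20,10), (8,13), (24,12),
    (17,3), (129,10), (137,10), (153,10), (193,11), (67,0), (323,0), (98,11), (289,11), (291,11),
    (354,11), (321,14), (323,14), (84,11), (24,6), (68,9), (76,9), (329,3), (265,8), (265,0),
    (40,10), (296,10), (74,0), (330,0), (322,6), (328,14), (330,14), (282,6), (66,6), (74,6),
    (42,9), (72,12), (74,14), (26,6), (28,9), (70,9), (78,9), (92,9), (89,3), (329,13), (84,3),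
    (92,3), (200,13), (216,13), (42,0), (106,0), (234,9), (202,14), (218,6), (220,9), (341,3),
    (348,13), (314,6), (1,0), (64,14), (4,0), (522,1), (586,1), (200,4), (202,4), (578,4), (586,4),
    (706,4), (648,9), (769,4), (904,10), (513,5), (260,8), (261,8), (268,6), (554,2), (234,4),
    (454,6), (769,1), (448,8), (704,11), (960,11), (832,14), (324,1), (596,5), (784,8), (312,2),
    (792,7), (840,12), (220,1), (440,6), (68,0), (292,6), (528,8), (40,2), (56,2), (568,2),
    (536,7), (568,9), (297,2), (313,2), (537,2), (793,2), (312,7), (313,7), (785,7), (793,7),
    (824,7), (824,10), (872,12), (841,13), (853,5), (833,13), (860,13), (969,13), (380,12),
    (728,13), (250,4), (168,0), (96,3), (232,4), (192,6), (300,0), (460,0), (356,3), (424,6),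
    (452,6), (460,6), (844,13), (837,13), (805,11), (301,2), (866,5), (98,4), (546,9), (578,12),
    (193,4), (195,4), (194,7), (641,11), (137,1), (153,1), (529,4), (537,4), (152,8), (649,10),
    (536,14), (12,2), (28,1), (516,10), (524,10), (520,13), (40,5), (32,3), (128,6), (588,9),
    (590,9), (70,5), (582,5), (578,8), (580,9), (582,9), (325,5), (327,5), (835,5), (326,8),
    (327,8), (771,8), (838,11), (366,12), (577,5), (324,8), (325,8), (769,8), (773,8), (356,6),
    (206,0), (284,2), (312,3), (298,2), (314,2), (538,2), (794,2), (786,7), (792,12), (897,10),
    (342,5), (196,3), (277,8), (261,1), (325,13), (664,1), (289,7), (14,1), (30,1), (526,1),
    (542,1), (28,5), (518,9), (526,9), (534,9), (542,9), (522,12), (538,12), (139,1), (155,1),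
    (651,1), (667,1), (153,4), (665,4), (797,13), (409,3), (285,13), (937,14), (425,14), (137,4),
    (649,4), (138,8), (34,4), (130,6), (129,4), (641,4), (643,4), (642,8), (514,14), (518,1),
    (532,5), (140,1), (156,1), (668,1), (664,13), (440,3), (396,0), (424,3), (428,6), (170,4),
    (650,14), (158,1), (391,8), (389,8), (773,13), (301,3), (385,3), (388,11), (261,13), (152,3),
    (276,3), (284,3), (408,3), (392,13), (408,13), (394,6), (269,13), (152,13), (84,2), (112,3),
    (368,3), (372,3), (304,6), (308,6), (372,6), (352,12), (356,12), (453,0), (481,3), (485,3),
    (867,14), (963,14), (193,0), (449,0), (224,10), (353,14), (369,3), (34,0), (160,9), (162,9),
    (226,9), (194,14), (22,1), (86,1), (146,6), (210,6), (148,9), (212,9), (214,9), (465,3),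
    (341,13), (453,13), (295,0), (401,3), (405,3), (404,10), (277,13), (389,13), (914,7), (531,1),
    (643,1), (659,1), (657,4), (658,7), (198,1), (214,1), (534,1), (710,1), (806,12), (372,12),
    (129,0), (385,0), (417,0), (416,10), (288,14), (289,14), (417,14), (276,2), (304,3), (292,12),
    (421,0), (530,2), (786,2), (802,2), (960,14), (226,0), (480,14), (641,1), (656,7), (196,1),
    (532,1), (596,1), (704,13), (736,9), (868,12), (804,12), (5,0), (69,0), (133,0), (197,0),
    (129,8), (193,8), (68,13), (196,13), (38,0), (102,0), (230,0), (162,6), (226,6), (164,11),
    (166,11), (228,11), (230,11), (186,6), (214,6), (222,6), (250,6), (726,8), (124,3), (184,6),
    (220,6), (248,6), (713,13), (696,7), (689,10), (150,6), (158,6), (662,8), (60,3), (156,6),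
    (188,6), (172,10), (180,10), (178,6), (170,6), (198,6), (206,6), (230,6), (710,8), (674,7),
    (676,11), (34,6), (98,6), (36,11), (38,11), (100,11), (102,11), (70,12), (7,0), (71,0),
    (131,8), (195,8), (199,8), (133,11), (197,11), (199,11), (93,3), (217,13), (29,3), (141,10),
    (149,10), (153,13), (47,0), (43,0), (107,0), (163,7), (39,0), (103,0), (165,11), (229,11),
    (56,6), (92,6), (120,12), (113,3), (585,13), (553,2), (568,7), (28,6), (60,6), (44,10),
    (52,10), (56,12), (49,3), (145,7), (161,10), (42,6), (70,6), (78,6), (102,6), (76,12),
    (108,12), (581,5), (582,8), (545,5), (546,7), (100,5), (548,11), (580,12), (259,4), (138,11),
    (266,14), (267,14), (394,14), (395,14), (270,12), (282,12), (18,4), (130,9), (131,11),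
    (386,11), (259,14), (387,14), (23,5), (22,11), (14,9), (10,12), (131,4), (138,14), (72,0),
    (104,0), (328,0), (360,0), (320,6), (328,6), (352,6), (360,6), (577,0), (609,11), (865,11),
    (65,1), (593,1), (80,8), (88,6), (104,9), (120,9), (329,0), (321,0), (352,11), (17,1), (81,1),
    (145,1), (209,1), (80,13), (208,13), (209,13), (50,1), (178,9), (242,9), (18,2), (274,2),
    (306,2), (272,12), (274,12), (145,10), (401,10), (273,13), (83,1), (82,1), (208,9), (3,7),
    (11,7), (35,7), (43,7), (9,14), (11,14), (41,14), (43,14), (21,7), (53,10), (61,10), (17,8),
    (81,8), (85,8), (65,13), (81,13), (35,11), (99,11), (67,14), (27,7), (25,7), (41,10), (5,5),
    (7,5), (517,5), (519,5), (6,8), (7,8), (518,8), (519,8), (44,5), (556,12), (558,12), (36,3),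
    (172,3), (132,6), (133,8), (517,13), (645,13), (39,5), (38,5), (518,12), (14,6), (520,2),
    (552,2), (776,2), (808,2), (768,7), (776,7), (800,7), (808,7), (580,2), (612,5), (868,5),
    (516,1), (708,1), (640,8), (644,8), (552,4), (680,4), (648,7), (780,2), (772,2), (800,5),
    (832,8), (144,3), (148,3), (400,3), (404,3), (384,13), (388,13), (400,13), (404,13), (166,0),
    (422,0), (162,3), (160,4), (672,4), (674,4), (640,14), (148,1), (660,1), (644,13), (656,13),
    (432,3), (388,0), (416,3), (386,14), (33,2), (49,2), (545,2), (561,2), (48,7), (49,7), (560,7),
    (561,7), (100,2), (612,12), (628,12), (36,0), (164,0), (228,0), (160,6), (164,6), (161,7),
    (672,7), (545,14), (673,14), (53,2), (52,2), (560,12), (112,6), (100,8), (545,8), (41,7),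
    (513,7), (521,7), (552,7), (517,8), (577,8)]"

text \<open>The entry \<open>(c, ls)\<close> is a normal graph together with \<open>3\<times>5\<close> matrices (columns coded in binary), whose
  functionals add up to one that is \<open>1\<close> on this graph and \<open>0\<close> on all later ones.\<close>
definition thetas :: "(int \<times> int list list) list" where
  "thetas = [
    (1,[[0,0,1,2,4]]), (2,[[0,1,0,2,4]]), (4,[[0,1,2,0,4]]), (8,[[0,1,2,4,0]]), (16,[[1,0,0,2,4]]),
    (32,[[1,0,2,0,4]]), (64,[[1,0,2,4,0]]), (128,[[1,2,0,0,4]]), (256,[[1,2,0,4,0]]),
    (512,[[1,2,4,0,0]]), (3,[[0,1,1,2,4]]), (5,[[0,1,2,1,4]]), (6,[[0,1,2,2,4]]),
    (9,[[0,1,2,4,1]]), (10,[[0,1,2,4,2]]), (12,[[0,1,2,4,4]]), (17,[[1,0,1,2,4]]),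
    (18,[[1,1,0,2,4]]), (33,[[1,0,2,1,4]]), (36,[[1,1,2,0,4]]), (48,[[1,0,2,2,4]]),
    (65,[[1,0,2,4,1]]), (72,[[1,1,2,4,0]]), (80,[[1,0,2,4,2]]), (96,[[1,0,2,4,4]]),
    (130,[[1,2,0,1,4]]), (132,[[1,2,1,0,4]]), (144,[[1,2,0,2,4]]), (160,[[1,2,2,0,4]]),
    (258,[[1,2,0,4,1]]), (264,[[1,2,1,4,0]]), (272,[[1,2,0,4,2]]), (320,[[1,2,2,4,0]]),
    (384,[[1,2,0,4,4]]), (516,[[1,2,4,0,1]]), (520,[[1,2,4,1,0]]), (544,[[1,2,4,0,2]]),
    (576,[[1,2,4,2,0]]), (640,[[1,2,4,0,4]]), (768,[[1,2,4,4,0]]), (7,[[0,1,2,3,4]]),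
    (11,[[0,1,2,4,3]]), (13,[[0,1,2,4,5]]), (14,[[0,1,2,4,6]]), (19,[[1,1,1,2,4]]),
    (37,[[1,1,2,1,4]]), (49,[[1,0,2,3,4]]), (73,[[1,1,2,4,1]]), (81,[[1,0,2,4,3]]),
    (97,[[1,0,2,4,5]]), (112,[[1,0,2,4,6]]), (134,[[1,2,1,1,4]]), (146,[[1,2,0,3,4]]),
    (164,[[1,2,3,0,4]]), (176,[[1,2,2,2,4]]), (266,[[1,2,1,4,1]]), (274,[[1,2,0,4,3]]),
    (328,[[1,2,3,4,0]]), (336,[[1,2,2,4,2]]), (386,[[1,2,0,4,5]]), (400,[[1,2,0,4,6]]),
    (524,[[1,2,4,1,1]]), (548,[[1,2,4,0,3]]), (584,[[1,2,4,3,0]]), (608,[[1,2,4,2,2]]),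
    (644,[[1,2,4,0,5]]), (672,[[1,2,4,0,6]]), (776,[[1,2,4,5,0]]), (832,[[1,2,4,6,0]]),
    (896,[[1,2,4,4,4]]), (15,[[0,1,2,4,7]]), (113,[[1,0,2,4,7]]), (402,[[1,2,0,4,7]]),
    (676,[[1,2,4,0,7]]), (840,[[1,2,4,7,0]]), (21,[[1,1,2,2,4],[1,1,2,3,4]]),
    (148,[[1,1,2,2,4],[1,2,3,3,4]]), (20,[[1,2,1,2,4]]), (161,[[1,2,3,2,4]]), (34,[[1,2,2,1,4]]),
    (38,[[1,2,3,1,4]]), (50,[[1,2,2,3,4]]), (22,[[1,1,2,2,4]]), (151,[[1,2,1,3,4]]),
    (280,[[1,1,2,4,2],[1,2,3,4,3]]), (69,[[1,1,2,4,4],[1,1,2,4,5]]),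
    (552,[[1,1,2,4,4],[1,2,4,3,3]]), (26,[[1,2,1,4,2],[1,2,1,4,3]]), (66,[[1,1,2,4,2]]),
    (321,[[1,2,1,4,2],[1,2,3,4,2]]), (257,[[1,2,2,4,1]]), (265,[[1,2,3,4,1]]), (273,[[1,2,2,4,3]]),
    (25,[[1,2,1,4,2]]), (91,[[1,1,2,4,3]]), (262,[[1,2,1,4,4],[1,2,1,4,5]]),
    (772,[[1,2,1,4,4],[1,2,4,5,5]]), (304,[[1,2,2,4,4],[1,2,2,4,6]]),
    (704,[[1,2,2,4,4],[1,2,4,6,6]]), (517,[[1,2,4,1,2],[1,2,4,1,3]]), (513,[[1,2,4,2,1]]),
    (76,[[1,2,4,3,1]]), (545,[[1,1,2,4,4],[1,2,4,3,2]]), (40,[[1,2,4,1,2]]), (104,[[1,1,2,4,4]]),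
    (613,[[1,2,4,2,3]]), (392,[[1,2,4,1,4],[1,2,4,5,4]]), (224,[[1,2,4,2,4],[1,2,4,2,6]]),
    (522,[[1,2,4,4,1],[1,2,4,5,1]]), (646,[[1,2,4,4,1],[1,2,4,4,5]]),
    (140,[[1,2,4,1,4],[1,2,4,1,5]]), (260,[[1,2,1,4,4]]), (514,[[1,2,4,4,1]]), (650,[[1,2,4,1,4]]),
    (592,[[1,2,4,4,2],[1,2,4,6,2]]), (416,[[1,2,4,4,2],[1,2,4,4,6]]), (192,[[1,2,2,4,4]]),
    (528,[[1,2,4,2,4]]), (784,[[1,2,4,4,2]]), (976,[[1,2,4,6,4]]), (43,[[1,1,2,4,6],[1,1,2,4,7]]),
    (515,[[1,2,4,1,6]]), (519,[[1,2,4,1,7]]), (395,[[1,2,1,4,6],[1,2,1,4,7]]),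
    (209,[[1,2,2,4,5],[1,2,2,4,7]]), (808,[[1,2,3,4,4],[1,2,4,7,7]]),
    (561,[[1,2,4,2,5],[1,2,4,2,7]]), (834,[[1,2,4,3,4],[1,2,4,7,4]]),
    (404,[[1,2,4,4,3],[1,2,4,4,7]]), (360,[[1,2,4,5,2],[1,2,4,7,2]]),
    (334,[[1,2,4,6,1],[1,2,4,7,1]]), (292,[[1,2,1,4,6],[1,2,4,5,2],[1,2,4,5,7]]),
    (290,[[1,2,4,4,3]]), (152,[[1,2,4,5,2],[1,2,4,5,6]]), (542,[[1,2,4,5,3],[1,2,4,5,7]]),
    (355,[[1,2,4,5,3],[1,2,4,6,3],[1,2,4,7,3]]),
    (451,[[1,2,3,4,4],[1,2,3,4,5],[1,2,3,4,6],[1,2,3,4,7]]),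
    (197,[[1,2,4,3,4],[1,2,4,3,5],[1,2,4,3,6],[1,2,4,3,7]]),
    (714,[[1,2,2,4,5],[1,2,3,4,5],[1,2,4,6,7],[1,2,4,7,6]]),
    (454,[[1,2,4,2,5],[1,2,4,3,5],[1,2,4,6,5],[1,2,4,7,5]]),
    (261,[[1,2,2,4,5],[1,2,3,4,4],[1,2,3,4,5]]), (28,[[1,2,1,4,6]]), (98,[[1,1,2,4,6]]),
    (578,[[1,2,4,6,1]]), (193,[[1,2,4,3,4],[1,2,4,3,6]]), (196,[[1,2,4,2,5]]), (200,[[1,2,3,4,4]]),
    (220,[[1,2,4,3,4],[1,2,4,3,5]]), (536,[[1,2,3,4,7],[1,2,4,7,3]]), (706,[[1,2,4,3,4]]),
    (961,[[1,2,2,4,5],[1,2,4,6,7]]), (785,[[1,2,4,6,5]]), (289,[[1,2,4,5,2]]), (354,[[1,2,2,4,5]]),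
    (372,[[1,2,3,4,6]])]"

definition codes :: "bool list list" where
  "codes = map (\<lambda>(c, _). bits 10 c) thetas"

definition covers :: "btree \<Rightarrow> btree \<Rightarrow> bool" where
  "covers t s = list_all (\<lambda>g. if is_star g then tmem g s else tmem g t) (all_bits 10)"

lemma rules_cover:
  "covers (run_rules (map quad_masks quads) rules (fold tins (filter (\<lambda>g. \<not> is_star g) codes) Tip))
     (fold tins (replicate 10 False # codes) Tip)"
  by code_simp

fun leq :: "bool list \<Rightarrow> bool list \<Rightarrow> bool" where
  "leq (g # gs) (m # ms) = (if g then (if m then leq gs ms else False) else leq gs ms)"
| "leq _ _ = True"

definition co_ends :: "(nat \<times> nat \<times> nat) list" where
  "co_ends = [(2,3,4), (1,3,4), (1,2,4), (1,2,3), (0,3,4), (0,2,4), (0,2,3), (0,1,4), (0,1,3), (0,1,2)]"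

definition det3 :: "bool list \<Rightarrow> bool list \<Rightarrow> bool list \<Rightarrow> bool" where
  "det3 a b c \<longleftrightarrow> ((a ! 0 \<and> ((b ! 1 \<and> c ! 2) \<noteq> (b ! 2 \<and> c ! 1))) \<noteq>
     (a ! 1 \<and> ((b ! 0 \<and> c ! 2) \<noteq> (b ! 2 \<and> c ! 0)))) \<noteq>
     (a ! 2 \<and> ((b ! 0 \<and> c ! 1) \<noteq> (b ! 1 \<and> c ! 0)))"

definition minors :: "int list \<Rightarrow> bool list" where
  "minors l = (let c = map (bits 3) l in map (\<lambda>(p, q, r). det3 (c ! p) (c ! q) (c ! r)) co_ends)"

fun theta_val :: "bool list list \<Rightarrow> bool list \<Rightarrow> bool" where
  "theta_val [] g = False"
| "theta_val (m # ms) g = (if leq g m then \<not> theta_val ms g else theta_val ms g)"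

fun triangular :: "(bool list \<times> bool list list) list \<Rightarrow> bool" where
  "triangular [] = True"
| "triangular ((g, ms) # rest) =
    (if theta_val ms g then (if list_all (\<lambda>(h, _). \<not> theta_val ms h) rest then triangular rest else False) else False)"

lemma rules_index: "list_all (\<lambda>(c, k). k < 15) rules"
  by code_simp

lemma length_codes: "length codes = 155" "length (filter (\<lambda>g. \<not> is_star g) codes) = 90"
  by code_simp+

lemma thetas_triangular:
  "triangular (map (\<lambda>(c, ls). (bits 10 c, map minors ls)) thetas)"
  by code_simp

section \<open>The dimension count\<close>

lemma set_ends: "set ends = {(i, j). i < j \<and> j < 5}"
proof
  show "{(i, j). i < j \<and> j < 5} \<subseteq> set ends"
  proof clarify
    fix i j :: nat assume "i < j" "j < 5"
    moreover from this have "j \<in> {0,1,2,3,4}" "i \<in> {0,1,2,3}" by auto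
    ultimately show "(i, j) \<in> set ends" by (auto simp: ends_def)
  qed
qed (auto simp: ends_def)

definition edge_list :: "nat set list" where
  "edge_list = map (\<lambda>(i, j). {i, j}) ends"

lemma set_edge_list: "set edge_list = edges"
proof
  show "set edge_list \<subseteq> edges" by (auto simp: edge_list_def set_ends intro!: edgesI)
  show "edges \<subseteq> set edge_list"
  proof
    fix e assume "e \<in> edges"
    then obtain i j where e: "e = {i,j}" and ij: "i < 5" "j < 5" "i \<noteq> j" unfolding edges_def by blast
    have "e = (\<lambda>(i, j). {i, j}) (min i j, max i j)" unfolding e by (auto simp: min_def max_def)
    moreover have "(min i j, max i j) \<in> set ends" using ij by (auto simp: set_ends min_def max_def)
    ultimately show "e \<in> set edge_list" unfolding edge_list_def set_map by (rule image_eqI)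
  qed
qed

lemma length_edge_list [simp]: "length edge_list = 10"
  by (simp add: edge_list_def ends_def)

lemma distinct_edge_list: "distinct edge_list"
proof -
  have "inj_on (\<lambda>(i, j). {i, j}) {(i, j). i < j \<and> j < (5::nat)}"
    by (auto simp: inj_on_def doubleton_eq_iff)
  moreover have "distinct ends" by (simp add: ends_def)
  ultimately show ?thesis by (simp add: edge_list_def distinct_map set_ends)
qed

fun sel :: "bool list \<Rightarrow> 'a list \<Rightarrow> 'a list" where
  "sel (b # bs) (x # xs) = (if b then x # sel bs xs else sel bs xs)"
| "sel _ _ = []"

lemma sel_map: "sel (map P xs) (map f xs) = map f (filter P xs)"
  by (induction xs) auto

lemma set_sel_subset: "set (sel bs xs) \<subseteq> set xs"
  by (induction bs xs rule: sel.induct) auto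

lemma distinct_sel: "distinct xs \<Longrightarrow> distinct (sel bs xs)"
  by (induction bs xs rule: sel.induct) (auto dest: subsetD[OF set_sel_subset])

lemma length_sel: "length bs = length xs \<Longrightarrow> length (sel bs xs) = count_true bs"
  by (induction bs xs rule: sel.induct) auto

lemma length_orl [simp]: "length as = length bs \<Longrightarrow> length (orl as bs) = length bs"
  by (induction as bs rule: orl.induct) auto

lemma set_sel_orl:
  "length as = length xs \<Longrightarrow> length bs = length xs \<Longrightarrow> set (sel (orl as bs) xs) = set (sel as xs) \<union> set (sel bs xs)"
proof (induction xs arbitrary: as bs)
  case (Cons x xs)
  then show ?case by (cases as; cases bs) auto
qed simp

definition graph :: "bool list \<Rightarrow> nat set list" where
  "graph g = sel g edge_list"

lemma graph_edges: "set (graph g) \<subseteq> edges"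
  using set_sel_subset[of g edge_list] by (simp add: graph_def set_edge_list)

lemma card_graph: "length g = 10 \<Longrightarrow> card (set (graph g)) = count_true g"
  by (simp add: graph_def distinct_card distinct_sel distinct_edge_list length_sel)

lemma graph_orl:
  "length g = 10 \<Longrightarrow> length h = 10 \<Longrightarrow> set (graph (orl g h)) = set (graph g) \<union> set (graph h)"
  by (simp add: graph_def set_sel_orl)

lemma length_bits [simp]: "length (bits n c) = n"
  by (induction n arbitrary: c) auto

lemma length_pair_mask [simp]: "length (pair_mask v x y z) = 10"
  by (simp add: pair_mask_def ends_def)

lemma graph_pair_mask:
  assumes "quad v x y z"
  shows "set (graph (pair_mask v x y z)) = {{v,x},{y,z}}"
proof -
  let ?P = "\<lambda>p. p = (v,x) \<or> p = (x,v) \<or> p = (y,z) \<or> p = (z,y)"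
  have "set (graph (pair_mask v x y z)) = (\<lambda>(i, j). {i,j}) ` {p \<in> set ends. ?P p}"
    unfolding graph_def pair_mask_def edge_list_def sel_map
    by (simp add: case_prod_unfold prod_eq_iff)
  also have "\<dots> = {{v,x},{y,z}}"
  proof -
    have "{p \<in> set ends. ?P p} = {(min v x, max v x), (min y z, max y z)}"
      using assms by (auto simp: set_ends quad_def min_def max_def)
    moreover have "{min v x, max v x} = {v,x}" "{min y z, max y z} = {y,z}" by (auto simp: min_def max_def)
    ultimately show ?thesis by simp
  qed
  finally show ?thesis .
qed

lemma quads_quad: "(v, x, y, z) \<in> set quads \<Longrightarrow> quad v x y z"
  by (auto simp: quads_def quad_def)

lemma is_star_at_iff: "length bs = length es \<Longrightarrow>
    is_star_at v bs es \<longleftrightarrow> (\<forall>e\<in>set (sel bs (map (\<lambda>(i, j). {i, j}) es)). v \<in> e)"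
  by (induction v bs es rule: is_star_at.induct) auto

lemma is_star_iff:
  assumes "length g = 10"
  shows "is_star g \<longleftrightarrow> (\<exists>v<5. \<forall>e\<in>set (graph g). v \<in> e)"
proof -
  have "length g = length ends" using assms by (simp add: ends_def)
  note * = is_star_at_iff[OF this, folded edge_list_def graph_def]
  have "(\<exists>v<5. P v) \<longleftrightarrow> (\<exists>v\<in>{0,1,2,3,4}. P v)" for P :: "nat \<Rightarrow> bool"
  proof -
    have "{..<5} = {0,1,2,3,4::nat}" by auto
    then show ?thesis by (metis lessThan_iff)
  qed
  then show ?thesis unfolding is_star_def by (simp add: * )
qed

definition word :: "nat \<Rightarrow> bool list \<Rightarrow> nat set list" where
  "word d g = graph g @ replicate (d - length (graph g)) (hd (graph g))"

abbreviation wm :: "nat \<Rightarrow> bool list \<Rightarrow> Defs.poly" where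
  "wm d g \<equiv> monomial (expo (word d g))"

lemma set_word: "graph g \<noteq> [] \<Longrightarrow> set (word d g) = set (graph g)"
  by (auto simp: word_def)

lemma length_word: "length g = 10 \<Longrightarrow> count_true g \<le> d \<Longrightarrow> length (word d g) = d"
  by (simp add: word_def graph_def length_sel)

lemma tmem_tins: "length g = length h \<Longrightarrow> tmem g (tins h t) \<Longrightarrow> g = h \<or> tmem g t"
proof (induction h t arbitrary: g rule: tins.induct)
  case (2 b bs)
  then show ?case by (cases g) (auto split: if_splits)
next
  case (3 b bs l r)
  then show ?case by (cases g) (auto split: if_splits)
qed auto

lemma tmem_fold_tins:
  "\<forall>h\<in>set hs. length h = length g \<Longrightarrow> tmem g (fold tins hs t) \<Longrightarrow> g \<in> set hs \<or> tmem g t"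
proof (induction hs arbitrary: t)
  case (Cons h hs)
  then have "g \<in> set hs \<or> tmem g (tins h t)" by simp
  then show ?case using tmem_tins[of g h t] Cons.prems by auto
qed simp

lemma all_bits_complete: "length g = n \<Longrightarrow> g \<in> set (all_bits n)"
proof (induction n arbitrary: g)
  case (Suc n)
  from Suc.prems obtain b bs where "g = b # bs" "length bs = n" by (cases g) simp_all
  then show ?case using Suc.IH by (cases b) auto
qed simp

definition reduced :: "nat \<Rightarrow> Defs.poly set \<Rightarrow> btree \<Rightarrow> bool" where
  "reduced d X t \<longleftrightarrow> (\<forall>g. length g = 10 \<longrightarrow> tmem g t \<longrightarrow> count_true g \<le> d \<longrightarrow> wm d g \<in> V.span X)"

lemma reduced_apply_rule:
  assumes d: "5 \<le> d" and X: "Kw d \<subseteq> X" and h: "length h = 10" and q: "quad v x y z" and t: "reduced d X t"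
  shows "reduced d X (apply_rule h (quad_masks (v, x, y, z)) t)"
proof -
  define g1 g2 g3 where "g1 = orl h (pair_mask v x y z)" and "g2 = orl h (pair_mask v y x z)"
    and "g3 = orl h (pair_mask v z x y)"
  note g_def = g1_def g2_def g3_def
  have q': "quad v y x z" "quad v z x y" using q by (auto simp: quad_def)
  have l: "length g1 = 10" "length g2 = 10" "length g3 = 10" using h by (simp_all add: g_def)
  have s: "set (graph g1) = set (graph h) \<union> {{v,x},{y,z}}" "set (graph g2) = set (graph h) \<union> {{v,y},{x,z}}"
    "set (graph g3) = set (graph h) \<union> {{v,z},{x,y}}"
    using h q q' by (simp_all add: g_def graph_orl graph_pair_mask)
  then have ne: "graph g1 \<noteq> []" "graph g2 \<noteq> []" "graph g3 \<noteq> []" by force+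
  have two: "card (A \<union> {a, b}) \<le> card A + 2" for A :: "nat set set" and a b
    using card_Un_le[of A "{a,b}"] card_insert_le_m1[of 2 "{b}" a] by simp
  have c: "count_true g2 \<le> count_true h + 2" "count_true g3 \<le> count_true h + 2"
    using two l h by (simp_all only: card_graph[symmetric] s)
  have new: "wm d g1 \<in> V.span X" if le: "count_true h + 2 \<le> max 5 (count_true g1)"
    and known: "g2 = g3 \<or> tmem g2 t \<and> tmem g3 t" and g1: "count_true g1 \<le> d"
  proof -
    have hd: "count_true h \<le> d - 2" and h2: "count_true h + 2 \<le> d" using le g1 d by auto
    have "wm d g1 + wm d g2 + wm d g3 \<in> Kw d"
      by (rule words_plucker[OF d q graph_edges, of h])
        (use hd h2 c g1 l h in \<open>simp_all add: length_word set_word ne s card_graph\<close>)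
    then have *: "wm d g1 + wm d g2 + wm d g3 \<in> V.span X" using X by (intro V.span_base) auto
    from known show ?thesis
    proof
      assume "g2 = g3"
      with * show ?thesis by (simp only: add.assoc poly_add_self add_0_right)
    next
      assume "tmem g2 t \<and> tmem g3 t"
      then have "wm d g2 \<in> V.span X" "wm d g3 \<in> V.span X" using t l c h2 by (auto simp: reduced_def)
      then have "(wm d g1 + wm d g2 + wm d g3) + (wm d g2 + wm d g3) \<in> V.span X"
        by (intro V.span_add[OF *] V.span_add)
      moreover have "(wm d g1 + wm d g2 + wm d g3) + (wm d g2 + wm d g3) =
          wm d g1 + (wm d g2 + wm d g2) + (wm d g3 + wm d g3)" by (simp only: ac_simps)
      ultimately show ?thesis by (simp only: poly_add_self add_0_right)
    qed
  qed
  show ?thesis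
  proof (cases "count_true h + 2 \<le> max 5 (count_true g1) \<and> (g2 = g3 \<or> tmem g2 t \<and> tmem g3 t)")
    case True
    then have "apply_rule h (quad_masks (v, x, y, z)) t = tins g1 t"
      by (auto simp: quad_masks_def g_def)
    moreover have "reduced d X (tins g1 t)"
      unfolding reduced_def using True new t l(1) tmem_tins[of _ g1 t] by (auto simp: reduced_def)
    ultimately show ?thesis by simp
  next
    case False
    then have "apply_rule h (quad_masks (v, x, y, z)) t = t"
      by (auto simp: quad_masks_def g_def)
    then show ?thesis using t by simp
  qed
qed

lemma reduced_run_rules:
  assumes "5 \<le> d" "Kw d \<subseteq> X" "list_all (\<lambda>(c, k). k < 15) rs" "reduced d X t"
  shows "reduced d X (run_rules (map quad_masks quads) rs t)"
  using assms(3,4)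
proof (induction rs arbitrary: t)
  case (Cons r rs)
  obtain c k where r: "r = (c, k)" by (cases r)
  have k: "k < length quads" using Cons.prems r by (simp add: quads_def)
  obtain v x y z where q: "quads ! k = (v, x, y, z)" by (metis prod_cases4)
  then have "quad v x y z" using nth_mem[OF k] by (intro quads_quad) simp
  then have "reduced d X (apply_rule (bits 10 c) (quad_masks (quads ! k)) t)"
    unfolding q using Cons.prems(2) assms(1,2) by (intro reduced_apply_rule) auto
  then show ?case using Cons.IH Cons.prems k by (simp add: r)
qed simp

lemma length_code: "g \<in> set codes \<Longrightarrow> length g = 10"
  by (auto simp: codes_def)

lemma graph_reduction:
  assumes "5 \<le> d" "length g = 10" "count_true g \<le> d"
  shows "is_star g \<Longrightarrow> g = replicate 10 False \<or> g \<in> set codes"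
    "\<not> is_star g \<Longrightarrow> wm d g \<in> V.span (Kw d \<union> wm d ` set (filter (\<lambda>g. \<not> is_star g) codes))"
proof -
  let ?t = "fold tins (filter (\<lambda>g. \<not> is_star g) codes) Tip" and ?s = "fold tins (replicate 10 False # codes) Tip"
  let ?X = "Kw d \<union> wm d ` set (filter (\<lambda>g. \<not> is_star g) codes)"
  have cov: "if is_star g then tmem g ?s else tmem g (run_rules (map quad_masks quads) rules ?t)"
    using rules_cover all_bits_complete[OF assms(2)] unfolding covers_def list_all_iff by blast
  show "g = replicate 10 False \<or> g \<in> set codes" if "is_star g"
  proof -
    have "tmem g ?s" using cov that by (simp only: if_True)
    then have "g \<in> set (replicate 10 False # codes) \<or> tmem g Tip"
      by (rule tmem_fold_tins[rotated]) (use assms(2) length_code in auto)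
    then show ?thesis by auto
  qed
  have "reduced d ?X ?t" unfolding reduced_def
  proof (intro allI impI)
    fix g :: "bool list" assume g: "length g = 10" "tmem g ?t"
    have "g \<in> set (filter (\<lambda>g. \<not> is_star g) codes) \<or> tmem g Tip"
      by (rule tmem_fold_tins[OF _ g(2)]) (use g(1) length_code in auto)
    then have "g \<in> set (filter (\<lambda>g. \<not> is_star g) codes)" by simp
    then show "wm d g \<in> V.span ?X" by (intro V.span_base UnI2 imageI)
  qed
  then have "reduced d ?X (run_rules (map quad_masks quads) rules ?t)"
    by (rule reduced_run_rules[OF assms(1) Un_upper1 rules_index])
  moreover assume "\<not> is_star g"
  then have "tmem g (run_rules (map quad_masks quads) rules ?t)" using cov by (simp only: if_False)
  ultimately show "wm d g \<in> V.span ?X" using assms by (simp add: reduced_def)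
qed

definition matrix :: "int list \<Rightarrow> nat \<Rightarrow> nat \<Rightarrow> bool" where
  "matrix l j i = bits 3 (l ! j) ! i"

lemma lindet_minors:
  assumes "length l = 5"
  shows "map (\<lambda>e. lindet (matrix l) ({..<5} - e)) edge_list = map of_bool (minors l)"
proof -
  have d: "lindet (matrix l) {p,q,r} = of_bool (det3 (map (bits 3) l ! p) (map (bits 3) l ! q) (map (bits 3) l ! r))"
    if "distinct [p,q,r]" "p < 5" "q < 5" "r < 5" for p q r
    unfolding lindet_three[OF that(1)] using that assms
    by (auto simp: det3_def matrix_def)
  have "{..<5} = {0,1,2,3,4::nat}" by auto
  then have c: "{..<5} - {0,1} = {2,3,4::nat}" "{..<5} - {0,2} = {1,3,4::nat}" "{..<5} - {0,3} = {1,2,4::nat}"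
    "{..<5} - {0,4} = {1,2,3::nat}" "{..<5} - {1,2} = {0,3,4::nat}" "{..<5} - {1,3} = {0,2,4::nat}"
    "{..<5} - {1,4} = {0,2,3::nat}" "{..<5} - {2,3} = {0,1,4::nat}" "{..<5} - {2,4} = {0,1,3::nat}"
    "{..<5} - {3,4} = {0,1,2::nat}" by (simp_all add: insert_Diff_if)
  show ?thesis
    unfolding edge_list_def ends_def minors_def co_ends_def Let_def list.map prod.case c list.inject
    by (intro conjI refl; rule d; simp)
qed

lemma prod_list_of_bool: "(\<Prod>x\<leftarrow>xs. of_bool (P x)) = (of_bool (\<forall>x\<in>set xs. P x) :: bit)"
  by (induction xs) auto

lemma leq_iff: "length g = length xs \<Longrightarrow> map f xs = map of_bool m \<Longrightarrow>
    leq g m \<longleftrightarrow> (\<forall>e\<in>set (sel g xs). f e = (1::bit))"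
proof (induction xs arbitrary: g m)
  case (Cons x xs)
  then obtain b g' c m' where "g = b # g'" "m = c # m'" by (cases g; cases m) auto
  then show ?case using Cons by auto
qed auto

lemma phi_wm:
  assumes "length l = 5" "length g = 10" "count_true g \<le> d" "graph g \<noteq> []"
  shows "phi (matrix l) d (wm d g) = of_bool (leq g (minors l))"
proof -
  let ?f = "\<lambda>e. lindet (matrix l) ({..<5} - e)"
  have w: "set (word d g) \<subseteq> edges" "length (word d g) = d"
    using graph_edges assms by (auto simp: set_word length_word)
  have f: "?f e = of_bool (?f e = 1)" for e by (cases "?f e") auto
  have "phi (matrix l) d (wm d g) = (\<Prod>e\<leftarrow>word d g. of_bool (?f e = 1))"
    unfolding phi_word[OF w] by (subst f) (rule refl)
  also have "\<dots> = of_bool (\<forall>e\<in>set (graph g). ?f e = 1)"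
    unfolding prod_list_of_bool set_word[OF assms(4)] ..
  also have "(\<forall>e\<in>set (graph g). ?f e = 1) = leq g (minors l)"
    unfolding graph_def by (rule leq_iff[symmetric, OF _ lindet_minors[OF assms(1)]]) (simp add: assms)
  finally show ?thesis .
qed

lemma sum_phi_wm:
  assumes "\<forall>l\<in>set ls. length l = 5" "length g = 10" "count_true g \<le> d" "graph g \<noteq> []"
  shows "(\<Sum>l\<leftarrow>ls. phi (matrix l) d (wm d g)) = of_bool (theta_val (map minors ls) g)"
  using assms(1)
proof (induction ls)
  case (Cons l ls)
  then show ?case using phi_wm[of l g d] assms(2-) by simp
qed simp

lemma thetas_lengths:
  "list_all (\<lambda>(c, ls). list_all (\<lambda>l. length l = 5) ls \<and> count_true (bits 10 c) \<le> 5 \<and> 0 < count_true (bits 10 c)) thetas"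
  by code_simp

lemma triangular_filter: "triangular xs \<Longrightarrow> triangular (filter P xs)"
  by (induction xs rule: triangular.induct) (auto simp: list_all_iff split: if_splits)

lemma independent_triangular:
  assumes "5 \<le> d" "V.independent B" "finite B" "B \<subseteq> Kw d"
    and "list_all (\<lambda>(c, ls). list_all (\<lambda>l. length l = 5) ls \<and> count_true (bits 10 c) \<le> 5 \<and> 0 < count_true (bits 10 c)) ts"
    and "triangular (map (\<lambda>(c, ls). (bits 10 c, map minors ls)) ts)"
  shows "V.independent (B \<union> wm d ` set (map (\<lambda>(c, _). bits 10 c) ts)) \<and>
    card (B \<union> wm d ` set (map (\<lambda>(c, _). bits 10 c) ts)) = card B + length ts"
  using assms(5,6)
proof (induction ts)
  case Nil
  show ?case using assms by simp
next
  case (Cons t ts)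
  obtain c ls where t: "t = (c, ls)" by (cases t)
  let ?S = "B \<union> wm d ` set (map (\<lambda>(c, _). bits 10 c) ts)" and ?x = "wm d (bits 10 c)"
  define \<theta> where "\<theta> f = (\<Sum>l\<leftarrow>ls. phi (matrix l) d f)" for f
  have val: "\<theta> (wm d (bits 10 c')) = of_bool (theta_val (map minors ls) (bits 10 c'))"
    if "(c', ls') \<in> set (t # ts)" for c' ls'
  proof -
    have *: "count_true (bits 10 c') \<le> 5" "0 < count_true (bits 10 c')"
      using Cons.prems(1) that unfolding list_all_iff by blast+
    then have "length (graph (bits 10 c')) \<noteq> 0" by (simp add: graph_def length_sel)
    then show ?thesis unfolding \<theta>_def
      using Cons.prems(1) * assms(1) t by (intro sum_phi_wm) (auto simp: list_all_iff)
  qed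
  have sub: "V.subspace {f. \<theta> f = 0}"
  proof (rule V.subspaceI)
    show "0 \<in> {f. \<theta> f = 0}" unfolding \<theta>_def by (induction ls) (auto simp: phi_def)
    show "x + y \<in> {f. \<theta> f = 0}" if "x \<in> {f. \<theta> f = 0}" "y \<in> {f. \<theta> f = 0}" for x y
    proof -
      have "\<theta> (x + y) = \<theta> x + \<theta> y" unfolding \<theta>_def phi_add by (rule sum_list_addf)
      then show ?thesis using that by simp
    qed
    show "scl k x \<in> {f. \<theta> f = 0}" if "x \<in> {f. \<theta> f = 0}" for k x
      using that unfolding \<theta>_def by (simp only: phi_scl sum_list_const_mult mem_Collect_eq mult_zero_right)
  qed
  have "?S \<subseteq> {f. \<theta> f = 0}"
  proof (rule Un_least)
    have "phi L d f = 0" if "f \<in> B" for L f using that assms(4) phi_Kw by blast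
    then show "B \<subseteq> {f. \<theta> f = 0}" unfolding \<theta>_def by (simp add: subset_iff)
    show "wm d ` set (map (\<lambda>(c, _). bits 10 c) ts) \<subseteq> {f. \<theta> f = 0}"
    proof
      fix f assume "f \<in> wm d ` set (map (\<lambda>(c, _). bits 10 c) ts)"
      then obtain c' ls' where c': "(c', ls') \<in> set ts" "f = wm d (bits 10 c')" by auto
      have "\<not> theta_val (map minors ls) (bits 10 c')"
        using Cons.prems(2) c'(1) t by (auto simp: list_all_iff split: if_splits)
      then show "f \<in> {f. \<theta> f = 0}" using val[of c' ls'] c' by simp
    qed
  qed
  then have "V.span ?S \<subseteq> {f. \<theta> f = 0}" by (rule V.span_minimal[OF _ sub])
  moreover have "\<theta> ?x = 1" using val[of c ls] Cons.prems(2) t by (auto split: if_splits)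
  ultimately have x: "?x \<notin> V.span ?S" by auto
  then have x': "?x \<notin> ?S" by (rule contra_subsetD[OF V.span_superset])
  have pr: "list_all (\<lambda>(c, ls). list_all (\<lambda>l. length l = 5) ls \<and> count_true (bits 10 c) \<le> 5 \<and>
      0 < count_true (bits 10 c)) ts" "triangular (map (\<lambda>(c, ls). (bits 10 c, map minors ls)) ts)"
    using Cons.prems unfolding t by (simp_all split: if_splits)
  note ih = Cons.IH[OF pr, THEN conjunct1] Cons.IH[OF pr, THEN conjunct2]
  have "B \<union> wm d ` set (map (\<lambda>(c, _). bits 10 c) (t # ts)) = insert ?x ?S" unfolding t by simp
  then show ?case using V.independent_insertI[OF x ih(1)] ih(2) x' assms(3) by simp
qed

lemma quot_image_dim_eq:
  assumes "5 \<le> d" and U: "U \<subseteq> V.span (Kw d \<union> wm d ` set (filter P codes))"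
    and P: "\<And>g. g \<in> set codes \<Longrightarrow> P g \<Longrightarrow> wm d g \<in> V.span (U \<union> Kw d)"
  shows "quot_image_dim U (Kw d) = length (filter P codes)"
proof -
  obtain B where B: "B \<subseteq> Kw d" "V.independent B" "Kw d \<subseteq> V.span B" "card B = V.dim (Kw d)"
    by (rule V.basis_exists)
  let ?F = "{monomial a | a. mono5 a \<and> mdeg a = deg_three_d d}"
  have "finite ?F" using finite_imageI[OF finite_degree, of monomial "deg_three_d d"]
    by (simp add: setcompr_eq_image)
  moreover have "B \<subseteq> V.span ?F"
  proof -
    have "Pw d \<subseteq> V.span ?F" unfolding Pw_def by (rule V.span_mono) auto
    then show ?thesis using B(1) unfolding Kw_def by (auto simp only: subset_iff Int_iff)
  qed
  ultimately have fin: "finite B" using V.independent_span_bound[OF _ B(2)] by blast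
  define ts where "ts = filter (\<lambda>(c, _). P (bits 10 c)) thetas"
  have ts: "map (\<lambda>(c, _). bits 10 c) ts = filter P codes"
    unfolding ts_def codes_def by (simp add: filter_map comp_def case_prod_unfold)
  have "triangular (map (\<lambda>(c, ls). (bits 10 c, map minors ls)) ts)"
  proof -
    have "map (\<lambda>(c, ls). (bits 10 c, map minors ls)) ts =
        filter (\<lambda>(g, _). P g) (map (\<lambda>(c, ls). (bits 10 c, map minors ls)) thetas)"
      unfolding ts_def by (simp add: filter_map comp_def case_prod_unfold)
    then show ?thesis using triangular_filter[OF thetas_triangular] by simp
  qed
  moreover have "list_all (\<lambda>(c, ls). list_all (\<lambda>l. length l = 5) ls \<and> count_true (bits 10 c) \<le> 5 \<and>
      0 < count_true (bits 10 c)) ts"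
    using thetas_lengths unfolding ts_def list_all_iff by simp
  ultimately have ind: "V.independent (B \<union> wm d ` set (filter P codes))"
    "card (B \<union> wm d ` set (filter P codes)) = card B + length ts"
    using independent_triangular[OF assms(1) B(2) fin B(1), of ts] unfolding ts by blast+
  have "V.span (U \<union> Kw d) = V.span (B \<union> wm d ` set (filter P codes))"
  proof (rule subset_antisym)
    let ?W = "wm d ` set (filter P codes)"
    have K: "Kw d \<subseteq> V.span (B \<union> ?W)" by (rule subset_trans[OF B(3) V.span_mono[OF Un_upper1]])
    have W: "?W \<subseteq> V.span (B \<union> ?W)" by (rule subset_trans[OF Un_upper2 V.span_superset])
    have "V.span (Kw d \<union> ?W) \<subseteq> V.span (B \<union> ?W)"
      by (rule V.span_minimal[OF Un_least[OF K W] V.subspace_span])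
    then show "V.span (U \<union> Kw d) \<subseteq> V.span (B \<union> ?W)"
      by (intro V.span_minimal[OF Un_least[OF _ K] V.subspace_span] subset_trans[OF U])
    show "V.span (B \<union> wm d ` set (filter P codes)) \<subseteq> V.span (U \<union> Kw d)"
    proof (rule V.span_minimal[OF _ V.subspace_span], rule Un_least)
      show "B \<subseteq> V.span (U \<union> Kw d)" 
        by (rule subset_trans[OF subset_trans[OF B(1) Un_upper2] V.span_superset])
      show "wm d ` set (filter P codes) \<subseteq> V.span (U \<union> Kw d)" using P by auto
    qed
  qed
  then have "V.dim (V.span (U \<union> Kw d)) = card B + length ts"
    using V.dim_span_eq_card_independent[OF ind(1)] ind(2) by simp
  moreover have "length ts = length (filter P codes)" using arg_cong[OF ts, of length] by simp
  ultimately show ?thesis unfolding quot_image_dim_def B(4)[symmetric] by simp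
qed

lemma expo_pos: "j < 5 \<Longrightarrow> 0 < expo w j \<longleftrightarrow> (\<exists>e\<in>set w. j \<notin> e)"
proof (induction w)
  case (Cons e w)
  then show ?case by (cases "j \<in> e") (simp_all add: level_in level_out)
qed simp

lemma monomial_reduction:
  assumes d: "5 \<le> d" and a: "mono5 a" "mdeg a = deg_three_d d"
      "weight a = three_d d \<or> wless (weight a) (three_d d)"
    and P: "\<And>g. \<not> is_star g \<Longrightarrow> P g"
    and star: "\<And>v. v < 5 \<Longrightarrow> a v = 0 \<Longrightarrow> P = (\<lambda>_. True)"
  shows "monomial a \<in> V.span (Kw d \<union> wm d ` set (filter P codes))"
proof (cases "wless (weight a) (three_d d)")
  case True
  have "monomial a \<in> Pw d" unfolding Pw_def using a by (intro V.span_base) auto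
  moreover have "monomial a \<in> Pw_minus d" unfolding Pw_minus_def using a True by (intro V.span_base) auto
  ultimately have "monomial a \<in> Kw d" unfolding Kw_def by (intro IntI V.span_base UnI2)
  then show ?thesis by (intro V.span_base) simp
next
  case False
  then obtain w where w: "length w = d" "set w \<subseteq> edges" "a = expo w" using ex_expo a by blast
  define g where "g = map (\<lambda>e. e \<in> set w) edge_list"
  have lg: "length g = 10" by (simp add: g_def)
  have "graph g = filter (\<lambda>e. e \<in> set w) edge_list"
    using sel_map[of "\<lambda>e. e \<in> set w" edge_list id] by (simp add: graph_def g_def)
  then have sg: "set (graph g) = set w" using w(2) set_edge_list by auto
  then have ne: "graph g \<noteq> []" using w d by auto
  have c: "count_true g \<le> d" using card_graph[OF lg] sg card_length[of w] w(1) by simp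
  have "monomial a + wm d g \<in> Kw d" unfolding w(3)
    by (rule words_same_set[OF d w(2)]) (use w sg ne lg c in \<open>simp_all add: set_word length_word\<close>)
  then have 1: "monomial a + wm d g \<in> V.span (Kw d \<union> wm d ` set (filter P codes))"
    by (intro V.span_base) simp
  have 2: "wm d g \<in> V.span (Kw d \<union> wm d ` set (filter P codes))"
  proof (cases "is_star g")
    case True
    then obtain v where v: "v < 5" "\<forall>e\<in>set w. v \<in> e" using is_star_iff[OF lg] sg by auto
    then have "a v = 0" using expo_pos[of v w] w(3) by auto
    then have P: "P = (\<lambda>_. True)" using star v by blast
    have "g \<noteq> replicate 10 False"
    proof
      assume "g = replicate 10 False"
      then have "count_true g = 0" by (simp add: numeral_eq_Suc)
      then show False using card_graph[OF lg] ne by simp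
    qed
    then have "g \<in> set codes" using graph_reduction(1)[OF d lg c True] by simp
    then show ?thesis unfolding P by (intro V.span_base) simp
  next
    case False
    have "set (filter (\<lambda>g. \<not> is_star g) codes) \<subseteq> set (filter P codes)" using P by auto
    then have "V.span (Kw d \<union> wm d ` set (filter (\<lambda>g. \<not> is_star g) codes)) \<subseteq>
        V.span (Kw d \<union> wm d ` set (filter P codes))" by (intro V.span_mono Un_mono image_mono) auto
    then show ?thesis using graph_reduction(2)[OF d lg c False] by blast
  qed
  from V.span_add[OF 1 2] show ?thesis by (simp only: add.assoc poly_add_self add_0_right)
qed

lemma code_props:
  assumes "5 \<le> d" "g \<in> set codes"
  shows "length g = 10" "count_true g \<le> d" "graph g \<noteq> []"
proof -
  show l: "length g = 10" using assms(2) by (rule length_code)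
  obtain c ls where "(c, ls) \<in> set thetas" "g = bits 10 c" using assms(2) by (auto simp: codes_def)
  then have "count_true g \<le> 5 \<and> 0 < count_true g" using thetas_lengths unfolding list_all_iff by blast
  then show "count_true g \<le> d" "graph g \<noteq> []" using assms(1) card_graph[OF l] by auto
qed

lemma code_word:
  assumes "5 \<le> d" "g \<in> set codes"
  shows "mono5 (expo (word d g))" "mdeg (expo (word d g)) = deg_three_d d" "weight (expo (word d g)) = three_d d"
    "\<not> is_star g \<Longrightarrow> j < 5 \<Longrightarrow> 0 < expo (word d g) j"
proof -
  note g = code_props[OF assms]
  have w: "set (word d g) \<subseteq> edges" "length (word d g) = d"
    using graph_edges g by (auto simp: set_word length_word)
  show "mono5 (expo (word d g))" by simp
  show "mdeg (expo (word d g)) = deg_three_d d"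
    using mdeg_levels[OF w(1), of "\<lambda>_. 0"] w(2) by (simp add: deg_three_d mdeg_def)
  show "weight (expo (word d g)) = three_d d" using weight_expo[OF w(1)] w(2) by simp
  show "0 < expo (word d g) j" if "\<not> is_star g" "j < 5"
    using that is_star_iff[OF g(1)] expo_pos[OF that(2)] set_word[OF g(3)] by auto
qed

theorem theorem4:
  fixes d :: nat
  assumes "d \<ge> 5"
  shows "dim_QP_plus d = 90 \<and> dim_QP d = 155"
proof
  let ?U = "{monomial a | a. mono5 a \<and> mdeg a = deg_three_d d
              \<and> (weight a = three_d d \<or> wless (weight a) (three_d d)) \<and> (\<forall>j<5. 0 < a j)}"
  have "dim_QP_plus d = length (filter (\<lambda>g. \<not> is_star g) codes)"
    unfolding dim_QP_plus_def
  proof (rule quot_image_dim_eq[OF assms])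
    show "V.span ?U \<subseteq> V.span (Kw d \<union> wm d ` set (filter (\<lambda>g. \<not> is_star g) codes))"
    proof (rule V.span_minimal[OF _ V.subspace_span], clarify)
      fix a assume "mono5 a" "mdeg a = deg_three_d d" "weight a = three_d d \<or> wless (weight a) (three_d d)"
        "\<forall>j<5. 0 < a j"
      then show "monomial a \<in> V.span (Kw d \<union> wm d ` set (filter (\<lambda>g. \<not> is_star g) codes))"
        by (intro monomial_reduction[OF assms]) auto
    qed
    show "wm d g \<in> V.span (V.span ?U \<union> Kw d)" if "g \<in> set codes" "\<not> is_star g" for g
      using code_word[OF assms that(1)] that(2) by (intro V.span_base UnI1 V.span_base) blast
  qed
  then show "dim_QP_plus d = 90" using length_codes(2) by simp
  have "dim_QP d = length (filter (\<lambda>_. True) codes)"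
    unfolding dim_QP_def
  proof (rule quot_image_dim_eq[OF assms])
    show "Pw d \<subseteq> V.span (Kw d \<union> wm d ` set (filter (\<lambda>_. True) codes))" unfolding Pw_def
    proof (rule V.span_minimal[OF _ V.subspace_span], clarify)
      fix a assume "mono5 a" "mdeg a = deg_three_d d" "weight a = three_d d \<or> wless (weight a) (three_d d)"
      then show "monomial a \<in> V.span (Kw d \<union> wm d ` set (filter (\<lambda>_. True) codes))"
        by (intro monomial_reduction[OF assms]) auto
    qed
    show "wm d g \<in> V.span (Pw d \<union> Kw d)" if "g \<in> set codes" for g
      using code_word[OF assms that] unfolding Pw_def by (intro V.span_base UnI1 V.span_base) blast
  qed
  then show "dim_QP d = 155" using length_codes(1) by simp
qed

end
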